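(* Assume that $p>1$ and $f:(0,+\infty)\to\mathbb{R}$ is a locally Lipschitz continuous function such that (i) $\lim_{t\to0^+} f(t) > 0$, (ii) $f$ is strictly decreasing on $(0,+\infty)$. Let $u \in C^{1,\alpha}_{\rm loc}(\mathbb{R}^N_+) \cap C(\overline{\mathbb{R}^N_+})$ be a (weak) solution to $$-\Delta_p u = f(u) \text{ in } \mathbb{R}^N_+,\qquad u>0 \text{ in } \mathbb{R}^N_+,\qquad u=0 \text{ on } \partial\mathbb{R}^N_+$$ with $u\in L^\infty(\Sigma_\lambda)$ for all $\lambda>0$. Then $u$ is monotone increasing in $x_N$. Moreover, if either $$\lim_{x_N\to+\infty} |\nabla u(x',x_N)|=0 \quad\text{uniformly in } x'\in\mathbb{R}^{N-1},$$ or $f$ is differentiable at all sufficiently large $t$ with $\limsup_{t\to+\infty} f'(t) < 0$ and $|\nabla u| \in L^\infty(\mathbb{R}^N_+\setminus\Sigma_{\overline\lambda})$ for some $\overline\lambda>0$, then $u$ depends only on $x_N$.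
   Context: $N\ge 1$ is an integer, $\mathbb{R}^N_+=\{x=(x',x_N)\in\mathbb{R}^{N-1}\times\mathbb{R} : x_N>0\}$, and $\Sigma_\lambda=\{(x',x_N)\in\mathbb{R}^N : 0<x_N<\lambda\}$ for $\lambda>0$. $\Delta_p u=\mathrm{div}(|\nabla u|^{p-2}\nabla u)$ is the $p$-Laplacian. The exponent $\alpha$ is some number in $(0,1)$. The limit of $f$ at $0^+$ may be $+\infty$. Solutions are understood weakly: $\int_{\mathbb{R}^N_+} (|\nabla u|^{p-2} \nabla u, \nabla \varphi) = \int_{\mathbb{R}^N_+} f(u) \varphi$ for all $\varphi\in C^1_c(\mathbb{R}^N_+)$; the conditions $u>0$ and $u=0$ on the boundary hold pointwise. "Monotone increasing in $x_N$" is meant in the non-strict sense, i.e. $\frac{\partial u}{\partial x_N}\ge 0$ in $\mathbb{R}^N_+$. *)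

theory Defs
  imports "HOL-Analysis.Analysis"
begin

text \<open>
  Euclidean space is \<^typ>\<open>real ^ 'n\<close> with \<^term>\<open>N = CARD('n)\<close>; since \<^typ>\<open>'n\<close> may have a single
  element, the case \<^term>\<open>N = 1\<close> is included. The index \<^term>\<open>k :: 'n\<close> marks the distinguished
  last coordinate $x_N$, and the remaining coordinates make up $x'$.
\<close>

definition halfspace :: "'n::finite \<Rightarrow> (real ^ 'n) set" where
  "halfspace k = {x. 0 < x $ k}"

definition strip :: "'n::finite \<Rightarrow> real \<Rightarrow> (real ^ 'n) set" where
  "strip k l = {x. 0 < x $ k \<and> x $ k < l}"

definition grad :: "('a::real_inner \<Rightarrow> real) \<Rightarrow> 'a \<Rightarrow> 'a" where
  "grad g x = (THE D. GDERIV g x :> D)"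

lemma grad_eqI:
  assumes "GDERIV g x :> D"
  shows "grad g x = D"
  unfolding grad_def
proof (rule the_equality)
  fix D' assume "GDERIV g x :> D'"
  then have "(\<lambda>h. h \<bullet> D') = (\<lambda>h. h \<bullet> D)"
    using assms unfolding gderiv_def by (rule has_derivative_unique)
  then show "D' = D"
    by (metis vector_eq_ldot)
qed (fact assms)

text \<open>The space $C^{1,\alpha}_{\rm loc}(U)$ for open \<^term>\<open>U\<close>.\<close>

definition C1_alpha_loc :: "real \<Rightarrow> 'a::euclidean_space set \<Rightarrow> ('a \<Rightarrow> real) \<Rightarrow> bool" where
  "C1_alpha_loc \<alpha> U g \<longleftrightarrow>
     (\<forall>x\<in>U. g differentiable (at x)) \<and> continuous_on U (grad g) \<and>
     (\<forall>K. compact K \<and> K \<subseteq> U \<longrightarrow>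
        (\<exists>C. \<forall>x\<in>K. \<forall>y\<in>K. norm (grad g x - grad g y) \<le> C * norm (x - y) powr \<alpha>))"

text \<open>
  The space $C^1_c(U)$ for open \<^term>\<open>U\<close>, each function being identified with its extension
  by zero to the whole space.
\<close>

definition C1_compact_support :: "'a::euclidean_space set \<Rightarrow> ('a \<Rightarrow> real) \<Rightarrow> bool" where
  "C1_compact_support U \<phi> \<longleftrightarrow>
     (\<forall>x. \<phi> differentiable (at x)) \<and> continuous_on UNIV (grad \<phi>) \<and>
     compact (closure {x. \<phi> x \<noteq> 0}) \<and> closure {x. \<phi> x \<noteq> 0} \<subseteq> U"

text \<open>
  The field $|\nabla g|^{p-2}\nabla g$, with the usual value 0 where the gradient vanishes:
  \<^term>\<open>0 powr (p - 2) = 0\<close> for every \<^term>\<open>p\<close>, and the factor \<^term>\<open>grad g x\<close> is 0 there anyway.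
\<close>

definition p_flux :: "real \<Rightarrow> ('a::euclidean_space \<Rightarrow> real) \<Rightarrow> 'a \<Rightarrow> 'a" where
  "p_flux p g x = norm (grad g x) powr (p - 2) *\<^sub>R grad g x"

text \<open>
  Weak form of $-\Delta_p u = f(u)$ in the open set \<^term>\<open>U\<close>. For \<^term>\<open>p > 1\<close>, $u \in C^1(U)$ positive
  and \<^term>\<open>f\<close> continuous on the positive reals, both integrands are continuous with compact
  support in \<^term>\<open>U\<close>, so the integrals are genuine.
\<close>

definition weak_p_Laplace_solution ::
    "real \<Rightarrow> (real \<Rightarrow> real) \<Rightarrow> 'a::euclidean_space set \<Rightarrow> ('a \<Rightarrow> real) \<Rightarrow> bool" where
  "weak_p_Laplace_solution p f U u \<longleftrightarrow>
     (\<forall>\<phi>. C1_compact_support U \<phi> \<longrightarrow>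
        (LINT x:U|lebesgue. p_flux p u x \<bullet> grad \<phi> x) = (LINT x:U|lebesgue. f (u x) * \<phi> x))"

definition L_infty :: "'a::euclidean_space set \<Rightarrow> ('a \<Rightarrow> real) \<Rightarrow> bool" where
  "L_infty S g \<longleftrightarrow>
     g \<in> borel_measurable (lebesgue_on S) \<and> (\<exists>C. AE x in lebesgue_on S. \<bar>g x\<bar> \<le> C)"

text \<open>The library notion is for families of functions; here the family is constant.\<close>

definition locally_lipschitz_on ::
    "'a::metric_space set \<Rightarrow> ('a \<Rightarrow> 'b::metric_space) \<Rightarrow> bool" where
  "locally_lipschitz_on S g \<longleftrightarrow> local_lipschitz (UNIV :: real set) S (\<lambda>_. g)"

text \<open>
  The limit at infinity in the direction of the coordinate \<^term>\<open>k\<close>, uniform in the others: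
  \<^term>\<open>y\<close> runs over the points $(x',0)$ and \<^term>\<open>y + t *\<^sub>R axis k 1\<close> is $(x',t)$.
\<close>

definition gradient_vanishes_at_infinity :: "'n::finite \<Rightarrow> (real ^ 'n \<Rightarrow> real) \<Rightarrow> bool" where
  "gradient_vanishes_at_infinity k u \<longleftrightarrow>
     uniform_limit {y. y $ k = 0} (\<lambda>t y. norm (grad u (y + t *\<^sub>R axis k 1))) (\<lambda>_. 0) at_top"

end

theory Submission
  imports Defs
begin

text \<open>
  Everything rests on one comparison principle on unbounded domains, \<open>comparison_up_to_eps\<close>: if \<open>u\<close> and \<open>v\<close> are
  positive solutions of the same equation and the set where \<open>u - v \<ge> \<epsilon>\<close> meets every closed ball in a
  compact subset of the domain, then \<open>u \<le> v + \<epsilon>\<close>, provided that \<open>u - v\<close> is bounded above and that,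
  on this set, \<open>f v - f u\<close> has a positive lower bound \<open>c\<close>, \<open>f u\<close> is bounded above, and \<open>u\<close> or its
  gradient is bounded at each point. Strict monotonicity of \<open>f\<close> supplies the gap \<open>c\<close>. Where \<open>u\<close> is
  bounded, no gradient estimate is required, and the behaviour at the boundary enters only through
  the compactness.

  With \<open>w = max 0 (u - v - \<epsilon>)\<close> and a cut-off \<open>\<zeta>\<close> living on a ball of radius \<open>R\<close>, the function
  \<open>w\<^sup>2 \<zeta>\<close> is a legitimate \<open>C\<^sup>1\<close> test function in both equations. Subtracting them produces the
  monotonicity energy of the field \<open>\<bar>\<xi>\<bar> powr (p - 2) *\<^sub>R \<xi>\<close> plus the good term \<open>c w\<^sup>2 \<zeta>\<close>, against an
  error containing the difference of the fluxes times \<open>w\<^sup>2 \<nabla>\<zeta>\<close>. For \<open>p \<le> 2\<close> the energy controls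
  that difference by itself. For \<open>p > 2\<close> the difference also grows with \<open>\<bar>\<nabla>u\<bar>\<close>; a small multiple of
  the equation of \<open>u\<close> tested with \<open>(1 - exp (- u)) w\<^sup>3 \<zeta>\<close> is added, which is a Caccioppoli
  inequality for \<open>u\<close> and whose own errors are absorbed by the same energy. The outcome is a
  pointwise lower bound (\<open>energy_density_lower_bound\<close>) whose single integration gives
  \<open>\<integral> w\<^sup>2 \<zeta> \<le> C R\<^sup>N R powr (- m)\<close>. Taking \<open>\<zeta>\<close> as the \<open>m\<close>-th power of a bump with \<open>m > max N p\<close> and
  letting \<open>R \<rightarrow> \<infinity>\<close> forces \<open>w = 0\<close>.

  Monotonicity is the method of reflection without any moving of planes: in every strip of height
  \<open>\<lambda>\<close> the solution is compared directly with its reflection in the top of the strip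
  (\<open>reflection_le\<close>). For the one-dimensional symmetry, \<open>u\<close> is compared on the half-space with its horizontal
  translates (\<open>translation_le_up_to_eps\<close>). If the gradient vanishes at infinity, then the difference is below \<open>\<epsilon>\<close>
  far from the boundary, so that only a strip, where \<open>u\<close> is bounded, matters. If the gradient is
  bounded, then the difference is bounded, and the condition on \<open>f'\<close> keeps the gap \<open>c\<close> positive
  although \<open>u\<close> may be unbounded. Exchanging a function and its translate gives equality.
\<close>

section \<open>The vector field of the p-Laplacian\<close>

definition p_field :: "real \<Rightarrow> 'a::real_inner \<Rightarrow> 'a" where
  "p_field p \<xi> = norm \<xi> powr (p - 2) *\<^sub>R \<xi>"

lemma p_flux_eq_p_field: "p_flux p g x = p_field p (grad g x)"
  by (simp add: p_flux_def p_field_def)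

text \<open>
  Young's inequality in the only form that is needed: with an arbitrarily small constant at one of
  the two powers. Comparing \<open>y\<close> with \<open>\<kappa> x\<close> replaces the usual convexity argument.
\<close>

lemma young_powr:
  fixes r s \<delta> :: real
  assumes "0 < r" "0 < s" "0 < \<delta>"
  obtains C where "0 < C"
    "\<And>x y. 0 \<le> x \<Longrightarrow> 0 \<le> y \<Longrightarrow> x powr r * y powr s \<le> \<delta> * x powr (r + s) + C * y powr (r + s)"
proof
  define \<kappa> where "\<kappa> = \<delta> powr (1 / s)"
  have \<kappa>: "0 < \<kappa>" "\<kappa> powr s = \<delta>"
    using assms by (auto simp: \<kappa>_def powr_powr)
  show "0 < (1 / \<kappa>) powr r" using \<kappa> by simp
  fix x y :: real assume xy: "0 \<le> x" "0 \<le> y"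
  show "x powr r * y powr s \<le> \<delta> * x powr (r + s) + (1 / \<kappa>) powr r * y powr (r + s)"
  proof (cases "y \<le> \<kappa> * x")
    case True
    have "x powr r * y powr s \<le> x powr r * (\<kappa> * x) powr s"
      using True xy assms by (intro mult_left_mono powr_mono2) auto
    also have "\<dots> = \<delta> * x powr (r + s)"
      using \<kappa> xy by (simp add: powr_mult powr_add)
    finally show ?thesis by (simp add: add_increasing2)
  next
    case False
    then have "x \<le> (1 / \<kappa>) * y" using \<kappa> by (simp add: field_simps)
    then have "x powr r * y powr s \<le> ((1 / \<kappa>) * y) powr r * y powr s"
      using xy assms by (intro mult_right_mono powr_mono2) auto
    also have "\<dots> = (1 / \<kappa>) powr r * y powr (r + s)"
      using \<kappa> xy powr_mult[of "1/\<kappa>" y r] by (simp add: powr_add)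
    finally show ?thesis using assms by (simp add: add_increasing)
  qed
qed

lemma norm_p_field: "norm (p_field p \<xi>) = norm \<xi> powr (p - 1)"
proof (cases "\<xi> = 0")
  case False
  then have "norm \<xi> powr (p - 2) * norm \<xi> = norm \<xi> powr (p - 2) * norm \<xi> powr 1" by simp
  also have "\<dots> = norm \<xi> powr (p - 1)" by (subst powr_add[symmetric]) simp
  finally show ?thesis by (simp add: p_field_def)
qed (simp add: p_field_def)

lemma p_field_inner_self: "p_field p \<xi> \<bullet> \<xi> = norm \<xi> powr p"
proof (cases "\<xi> = 0")
  case False
  then have "norm \<xi> powr (p - 2) * (norm \<xi>)\<^sup>2 = norm \<xi> powr (p - 2) * norm \<xi> powr 2" by simp
  also have "\<dots> = norm \<xi> powr p" by (subst powr_add[symmetric]) simp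
  finally show ?thesis by (simp add: p_field_def dot_square_norm)
qed (simp add: p_field_def)

text \<open>
  The fields of conjugate exponents are inverse to each other. This turns estimates for
  \<open>p \<ge> 2\<close> into estimates for \<open>p \<le> 2\<close>.
\<close>

lemma p_field_conjugate:
  assumes "1 < p"
  shows "p_field (p / (p - 1)) (p_field p \<xi>) = \<xi>"
proof (cases "\<xi> = 0")
  case False
  have e: "(p - 1) * (p / (p - 1) - 2) + (p - 2) = 0"
    using assms by (simp add: field_simps)
  have "p_field (p / (p - 1)) (p_field p \<xi>)
      = (norm \<xi> powr ((p - 1) * (p / (p - 1) - 2)) * norm \<xi> powr (p - 2)) *\<^sub>R \<xi>"
    unfolding p_field_def[of "p / (p-1)"] norm_p_field by (simp add: p_field_def powr_powr)
  also have "\<dots> = \<xi>"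
    unfolding powr_add[symmetric] e using False by simp
  finally show ?thesis .
qed (simp add: p_field_def)

lemma continuous_p_field:
  assumes "1 < p"
  shows "continuous_on UNIV (p_field p :: 'a::real_inner \<Rightarrow> 'a)"
proof -
  have "isCont (p_field p) \<xi>" for \<xi> :: 'a
  proof (cases "\<xi> = 0")
    case True
    have "((\<lambda>\<xi>::'a. norm \<xi> powr (p - 1)) \<longlongrightarrow> 0) (at 0)"
      using assms by (auto intro!: tendsto_eq_intros)
    then have "((\<lambda>\<xi>::'a. norm (p_field p \<xi>)) \<longlongrightarrow> 0) (at 0)"
      by (simp add: norm_p_field)
    then have "(p_field p \<longlongrightarrow> (0::'a)) (at 0)"
      by (rule tendsto_norm_zero_cancel)
    then show ?thesis using True by (simp add: isCont_def p_field_def)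
  next
    case False
    then show ?thesis unfolding p_field_def by (intro continuous_intros) auto
  qed
  then show ?thesis by (simp add: continuous_at_imp_continuous_on)
qed

text \<open>
  Twice the energy equals the left-hand side plus
  \<open>(\<bar>\<xi>\<bar> powr (p - 2) - \<bar>\<eta>\<bar> powr (p - 2)) (\<bar>\<xi>\<bar>\<^sup>2 - \<bar>\<eta>\<bar>\<^sup>2)\<close>, a product of two factors of the same sign.
\<close>

lemma p_field_monotone:
  fixes \<xi> \<eta> :: "'a::real_inner"
  assumes "2 < p"
  shows "(norm \<xi> powr (p - 2) + norm \<eta> powr (p - 2)) * (norm (\<xi> - \<eta>))\<^sup>2
           \<le> 2 * ((p_field p \<xi> - p_field p \<eta>) \<bullet> (\<xi> - \<eta>))"
proof -
  define a b where "a = norm \<xi> powr (p - 2)" and "b = norm \<eta> powr (p - 2)"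
  have "0 \<le> (a - b) * ((norm \<xi>)\<^sup>2 - (norm \<eta>)\<^sup>2)"
  proof (cases "norm \<xi> \<le> norm \<eta>")
    case True
    then have "a \<le> b" unfolding a_def b_def using assms by (intro powr_mono2) auto
    moreover have "(norm \<xi>)\<^sup>2 \<le> (norm \<eta>)\<^sup>2" using True by (intro power_mono) auto
    ultimately show ?thesis by (intro mult_nonpos_nonpos) auto
  next
    case False
    then have "b \<le> a" unfolding a_def b_def using assms by (intro powr_mono2) auto
    moreover have "(norm \<eta>)\<^sup>2 \<le> (norm \<xi>)\<^sup>2" using False by (intro power_mono) auto
    ultimately show ?thesis by (intro mult_nonneg_nonneg) auto
  qed
  moreover have "2 * ((a *\<^sub>R \<xi> - b *\<^sub>R \<eta>) \<bullet> (\<xi> - \<eta>))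
      = (a + b) * (norm (\<xi> - \<eta>))\<^sup>2 + (a - b) * ((norm \<xi>)\<^sup>2 - (norm \<eta>)\<^sup>2)"
    unfolding power2_norm_eq_inner by (simp add: inner_simps inner_commute[of \<eta> \<xi>]) algebra
  ultimately show ?thesis unfolding p_field_def a_def[symmetric] b_def[symmetric] by linarith
qed

lemma p_field_coercive:
  fixes \<xi> \<eta> :: "'a::real_inner"
  assumes "2 \<le> p"
  shows "norm (\<xi> - \<eta>) powr p \<le> 2 powr (p - 1) * ((p_field p \<xi> - p_field p \<eta>) \<bullet> (\<xi> - \<eta>))"
proof (cases "p = 2")
  case True
  have *: "p_field 2 \<zeta> = \<zeta>" for \<zeta> :: 'a by (cases "\<zeta> = 0") (simp_all add: p_field_def)
  show ?thesis unfolding True * by (simp add: dot_square_norm)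
next
  case False
  then have p: "2 < p" using assms by simp
  define d m where "d = norm (\<xi> - \<eta>)" and "m = max (norm \<xi>) (norm \<eta>)"
  have "d \<le> 2 * m" unfolding d_def m_def using norm_triangle_ineq4[of \<xi> \<eta>] by linarith
  then have "d powr (p - 2) \<le> (2 * m) powr (p - 2)"
    unfolding d_def m_def using p by (intro powr_mono2) auto
  also have "\<dots> = 2 powr (p - 2) * m powr (p - 2)"
    by (simp add: powr_mult m_def max_def)
  also have "\<dots> \<le> 2 powr (p - 2) * (norm \<xi> powr (p - 2) + norm \<eta> powr (p - 2))"
    unfolding m_def max_def by (intro mult_left_mono) auto
  finally have *: "d powr (p - 2) * d\<^sup>2
      \<le> 2 powr (p - 2) * (norm \<xi> powr (p - 2) + norm \<eta> powr (p - 2)) * d\<^sup>2"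
    by (rule mult_right_mono) simp
  have "d powr p = d powr (p - 2) * d\<^sup>2"
  proof (cases "d = 0")
    case False
    then have "d powr (p - 2) * d\<^sup>2 = d powr (p - 2) * d powr 2" by (simp add: d_def)
    also have "\<dots> = d powr p" by (subst powr_add[symmetric]) simp
    finally show ?thesis by simp
  qed simp
  also note *
  also have "2 powr (p - 2) * (norm \<xi> powr (p - 2) + norm \<eta> powr (p - 2)) * d\<^sup>2
      \<le> 2 powr (p - 2) * (2 * ((p_field p \<xi> - p_field p \<eta>) \<bullet> (\<xi> - \<eta>)))"
    unfolding d_def mult.assoc using p_field_monotone[OF p, of \<xi> \<eta>] by (intro mult_left_mono) auto
  also have "\<dots> = (2 powr (p - 2) * 2 powr 1) * ((p_field p \<xi> - p_field p \<eta>) \<bullet> (\<xi> - \<eta>))"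
    by simp
  also have "2 powr (p - 2) * 2 powr 1 = 2 powr (p - 1)"
    by (subst powr_add[symmetric]) simp
  finally show ?thesis unfolding d_def .
qed

text \<open>
  The previous estimate for the conjugate exponent, applied to the two fluxes in place of the two
  gradients. It says that for \<open>p \<le> 2\<close> the energy alone controls the difference of the fluxes.
\<close>

lemma p_field_coercive_dual:
  fixes \<xi> \<eta> :: "'a::real_inner"
  assumes "1 < p" "p \<le> 2"
  shows "norm (p_field p \<xi> - p_field p \<eta>) powr (p / (p - 1))
           \<le> 2 powr (1 / (p - 1)) * ((p_field p \<xi> - p_field p \<eta>) \<bullet> (\<xi> - \<eta>))"
proof -
  have "2 \<le> p / (p - 1)" and e: "p / (p - 1) - 1 = 1 / (p - 1)" using assms by (auto simp: field_simps)
  from p_field_coercive[OF this(1), of "p_field p \<xi>" "p_field p \<eta>"] show ?thesis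
    unfolding p_field_conjugate[OF assms(1)] e by (simp add: inner_commute)
qed

text \<open>
  Splitting off \<open>\<bar>\<xi>\<bar> powr (p - 2) *\<^sub>R (\<xi> - \<eta>)\<close> for the longer vector \<open>\<xi>\<close> leaves a difference of powers,
  to which the mean value theorem applies.
\<close>

lemma p_field_difference_bound:
  fixes \<xi> \<eta> :: "'a::real_inner"
  assumes "2 < p"
  shows "norm (p_field p \<xi> - p_field p \<eta>)
           \<le> (p - 1) * (norm \<xi> powr (p - 2) + norm \<eta> powr (p - 2)) * norm (\<xi> - \<eta>)"
proof -
  define q where "q = p - 2"
  have q: "0 < q" using assms by (simp add: q_def)
  have mv: "(a powr q - b powr q) * b \<le> q * a powr q * (a - b)" if ab: "0 \<le> b" "b \<le> a" for a b
  proof (cases "b = 0 \<or> a = b")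
    case False
    then have ab': "0 < b" "b < a" using ab by auto
    have "\<exists>z. b < z \<and> z < a \<and> a powr q - b powr q = (a - b) * (q * z powr (q - 1))"
      using ab' by (intro MVT2) (auto intro!: derivative_eq_intros)
    then obtain z where z: "b < z" "z < a" "a powr q - b powr q = (a - b) * (q * z powr (q - 1))"
      by auto
    have "z powr (q - 1) * b \<le> z powr (q - 1) * z powr 1" using z ab' by (intro mult_left_mono) auto
    also have "\<dots> = z powr q" by (subst powr_add[symmetric]) simp
    also have "\<dots> \<le> a powr q" using z ab' q by (intro powr_mono2) auto
    finally have "(a - b) * q * (z powr (q - 1) * b) \<le> (a - b) * q * a powr q"
      using ab' q by (intro mult_left_mono) auto
    then show ?thesis unfolding z(3) by (simp add: mult_ac)
  qed (use ab q in auto)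
  have main: "norm (p_field p \<xi> - p_field p \<eta>) \<le> (1 + q) * norm \<xi> powr q * norm (\<xi> - \<eta>)"
    if le: "norm \<eta> \<le> norm \<xi>" for \<xi> \<eta> :: 'a
  proof -
    have pw: "norm \<eta> powr q \<le> norm \<xi> powr q" using le q by (intro powr_mono2) auto
    have "p_field p \<xi> - p_field p \<eta> = norm \<xi> powr q *\<^sub>R (\<xi> - \<eta>) + (norm \<xi> powr q - norm \<eta> powr q) *\<^sub>R \<eta>"
      unfolding p_field_def q_def by (simp add: algebra_simps)
    then have "norm (p_field p \<xi> - p_field p \<eta>)
        \<le> norm (norm \<xi> powr q *\<^sub>R (\<xi> - \<eta>)) + norm ((norm \<xi> powr q - norm \<eta> powr q) *\<^sub>R \<eta>)"
      by (metis norm_triangle_ineq)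
    also have "\<dots> = norm \<xi> powr q * norm (\<xi> - \<eta>) + (norm \<xi> powr q - norm \<eta> powr q) * norm \<eta>"
      using pw by simp
    also have "\<dots> \<le> norm \<xi> powr q * norm (\<xi> - \<eta>) + q * norm \<xi> powr q * (norm \<xi> - norm \<eta>)"
      using mv[OF _ le] by simp
    also have "\<dots> \<le> norm \<xi> powr q * norm (\<xi> - \<eta>) + q * norm \<xi> powr q * norm (\<xi> - \<eta>)"
      using q by (intro add_left_mono mult_left_mono norm_triangle_ineq2) auto
    finally show ?thesis by (simp add: algebra_simps)
  qed
  have mono: "(1 + q) * norm \<xi> powr q * norm (\<xi> - \<eta>) \<le> (1 + q) * (norm \<xi> powr q + norm \<eta> powr q) * norm (\<xi> - \<eta>)"
    for \<xi> \<eta> :: 'a using q by (intro mult_right_mono mult_left_mono) auto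
  have "norm (p_field p \<xi> - p_field p \<eta>)
      \<le> (1 + q) * (norm \<xi> powr q + norm \<eta> powr q) * norm (\<xi> - \<eta>)"
  proof (cases "norm \<eta> \<le> norm \<xi>")
    case True
    then show ?thesis using main[OF True] mono[of \<xi> \<eta>] by linarith
  next
    case False
    then show ?thesis using main[of \<xi> \<eta>] mono[of \<eta> \<xi>]
      by (simp add: norm_minus_commute add.commute)
  qed
  then show ?thesis by (simp add: q_def)
qed

section \<open>A pointwise energy estimate\<close>

text \<open>
  For \<open>p > 2\<close> the error term of the comparison argument is absorbed in three places: part of the
  energy, a small multiple of \<open>\<bar>\<xi>\<bar> powr p * w\<^sup>2\<close> (to be paid for by the Caccioppoli term), and a power of
  the cut-off gradient. The vector \<open>\<eta>\<close> needs no such payment, because \<open>\<bar>\<eta>\<bar> \<le> \<bar>\<xi>\<bar> + \<bar>\<xi> - \<eta>\<bar>\<close> and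
  the energy dominates \<open>\<bar>\<xi> - \<eta>\<bar> powr p\<close>.
\<close>

lemma flux_difference_absorbed:
  fixes \<delta> M p :: real
  assumes "2 < p" "0 < M" "0 < \<delta>"
  obtains C where "0 < C"
    "\<And>(\<xi>::'a::real_inner) \<eta> w s. 0 < w \<Longrightarrow> w \<le> M \<Longrightarrow> 0 \<le> s \<Longrightarrow>
       norm (p_field p \<xi> - p_field p \<eta>) * w * s
         \<le> 3/2 * ((p_field p \<xi> - p_field p \<eta>) \<bullet> (\<xi> - \<eta>))
            + \<delta> * norm \<xi> powr p * w\<^sup>2 + C * w * s powr p"
proof -
  define P L where "P = (p - 1)\<^sup>2 / 2" and "L = 1 + 2 powr (p - 2)"
  have pos: "0 < P" "1 < L" using assms by (auto simp: P_def L_def)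
  \<comment> \<open>Small enough for the budget \<open>\<delta>\<close>, and for spending at most half of the energy on \<open>\<bar>\<xi> - \<eta>\<bar> powr p\<close>.\<close>
  define \<delta>1 where "\<delta>1 = min (\<delta> / (P * L)) (1 / (2 * P * L * M\<^sup>2 * 2 powr (p - 1)))"
  have \<delta>1: "0 < \<delta>1" using pos assms by (simp add: \<delta>1_def)
  have \<delta>1a: "P * L * \<delta>1 \<le> \<delta>"
    using pos min.cobounded1[of "\<delta> / (P * L)"] by (simp add: \<delta>1_def field_simps min_def)
  have \<delta>1b: "P * L * M\<^sup>2 * \<delta>1 * 2 powr (p - 1) \<le> 1/2"
  proof -
    have "\<delta>1 \<le> 1 / (2 * P * L * M\<^sup>2 * 2 powr (p - 1))" by (simp add: \<delta>1_def)
    then show ?thesis using pos assms by (simp add: field_simps)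
  qed
  obtain C1 where C1: "0 < C1"
    "\<And>x y. 0 \<le> x \<Longrightarrow> 0 \<le> y \<Longrightarrow> x powr (p - 2) * y powr 2 \<le> \<delta>1 * x powr p + C1 * y powr p"
    using young_powr[of "p - 2" 2 \<delta>1] \<delta>1 assms by auto
  show ?thesis
  proof (rule that[of "2 * P * L * C1 * M"])
    show "0 < 2 * P * L * C1 * M" using pos assms C1 by simp
    fix \<xi> \<eta> :: 'a and w s :: real assume w: "0 < w" "w \<le> M" and s: "0 \<le> s"
    define E D S where "E = (p_field p \<xi> - p_field p \<eta>) \<bullet> (\<xi> - \<eta>)"
      and "D = norm (\<xi> - \<eta>)" and "S = norm \<xi> powr (p - 2) + norm \<eta> powr (p - 2)"
    have D: "0 \<le> D" by (simp add: D_def)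
    have S: "0 \<le> S" by (simp add: S_def)
    have SE: "S * D\<^sup>2 \<le> 2 * E" unfolding S_def D_def E_def using p_field_monotone[OF assms(1)] by auto
    have E: "0 \<le> E"
    proof -
      have "0 \<le> S * D\<^sup>2" using S by simp
      with SE show ?thesis by linarith
    qed
    have DE: "D powr p \<le> 2 powr (p - 1) * E"
      unfolding D_def E_def using assms by (intro p_field_coercive) simp
    have S_le: "S \<le> L * (norm \<xi> powr (p - 2) + D powr (p - 2))"
    proof -
      have "norm \<eta> \<le> norm \<xi> + D" unfolding D_def by (metis norm_minus_commute norm_triangle_sub)
      then have "norm \<eta> \<le> 2 * max (norm \<xi>) D" by auto
      then have "norm \<eta> powr (p - 2) \<le> (2 * max (norm \<xi>) D) powr (p - 2)"
        using assms by (intro powr_mono2) auto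
      also have "\<dots> = 2 powr (p - 2) * max (norm \<xi>) D powr (p - 2)"
        using D by (simp add: powr_mult max_def)
      also have "\<dots> \<le> 2 powr (p - 2) * (norm \<xi> powr (p - 2) + D powr (p - 2))"
        by (intro mult_left_mono) (auto simp: max_def)
      finally have "S \<le> norm \<xi> powr (p - 2) + 2 powr (p - 2) * (norm \<xi> powr (p - 2) + D powr (p - 2))"
        by (simp add: S_def)
      also have "\<dots> \<le> L * (norm \<xi> powr (p - 2) + D powr (p - 2))"
        by (simp add: L_def algebra_simps)
      finally show ?thesis .
    qed
    have "S * s\<^sup>2 \<le> L * (norm \<xi> powr (p - 2) + D powr (p - 2)) * s\<^sup>2"
      using S_le by (rule mult_right_mono) simp
    also have "\<dots> = L * (norm \<xi> powr (p - 2) * s powr 2 + D powr (p - 2) * s powr 2)"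
      using s by (cases "s = 0") (auto simp: algebra_simps)
    also have "\<dots> \<le> L * ((\<delta>1 * norm \<xi> powr p + C1 * s powr p) + (\<delta>1 * D powr p + C1 * s powr p))"
      using pos s D C1(2) by (intro mult_left_mono add_mono) auto
    also have "\<dots> \<le> L * ((\<delta>1 * norm \<xi> powr p + C1 * s powr p) + (\<delta>1 * (2 powr (p - 1) * E) + C1 * s powr p))"
      using pos \<delta>1 DE C1(1) by (intro mult_left_mono add_mono) auto
    finally have Ss: "S * s\<^sup>2 \<le> L * (\<delta>1 * norm \<xi> powr p + \<delta>1 * 2 powr (p - 1) * E + 2 * C1 * s powr p)"
      by (simp add: algebra_simps)
    have w2: "w\<^sup>2 \<le> M\<^sup>2" "w\<^sup>2 \<le> M * w"
      using w by (auto simp: power2_eq_square intro: mult_mono)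
    have "norm (p_field p \<xi> - p_field p \<eta>) * (w * s) \<le> (p - 1) * S * D * (w * s)"
      unfolding S_def D_def using p_field_difference_bound[OF assms(1)] w s by (intro mult_right_mono) auto
    also have "\<dots> = S * (D * ((p - 1) * w * s))" by simp
    also have "\<dots> \<le> S * (D\<^sup>2 / 2 + ((p - 1) * w * s)\<^sup>2 / 2)"
      using S sum_squares_bound[of D "(p - 1) * w * s"] by (intro mult_left_mono) auto
    also have "\<dots> = S * D\<^sup>2 / 2 + P * w\<^sup>2 * (S * s\<^sup>2)"
      unfolding P_def power_mult_distrib by (simp add: algebra_simps)
    also have "\<dots> \<le> E + P * w\<^sup>2 * (L * (\<delta>1 * norm \<xi> powr p + \<delta>1 * 2 powr (p - 1) * E + 2 * C1 * s powr p))"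
      using SE Ss pos by (intro add_mono mult_left_mono) auto
    also have "\<dots> = E + (P * L * \<delta>1) * (norm \<xi> powr p * w\<^sup>2) + (P * L * \<delta>1 * 2 powr (p - 1) * E) * w\<^sup>2
        + (2 * P * L * C1 * s powr p) * w\<^sup>2"
      by (simp add: algebra_simps)
    also have "\<dots> \<le> E + \<delta> * (norm \<xi> powr p * w\<^sup>2) + (P * L * \<delta>1 * 2 powr (p - 1) * E) * M\<^sup>2
        + (2 * P * L * C1 * s powr p) * (M * w)"
      using \<delta>1a w2 pos \<delta>1 E C1 by (intro add_mono mult_left_mono mult_right_mono) auto
    also have "\<dots> = E + (P * L * M\<^sup>2 * \<delta>1 * 2 powr (p - 1)) * E + \<delta> * norm \<xi> powr p * w\<^sup>2
        + 2 * P * L * C1 * M * w * s powr p"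
      by (simp add: algebra_simps)
    also have "\<dots> \<le> E + 1/2 * E + \<delta> * norm \<xi> powr p * w\<^sup>2 + 2 * P * L * C1 * M * w * s powr p"
      using mult_right_mono[OF \<delta>1b E] by simp
    finally show "norm (p_field p \<xi> - p_field p \<eta>) * w * s \<le> 3/2 * ((p_field p \<xi> - p_field p \<eta>) \<bullet> (\<xi> - \<eta>))
            + \<delta> * norm \<xi> powr p * w\<^sup>2 + 2 * P * L * C1 * M * w * s powr p"
      unfolding E_def by (simp add: mult.assoc)
  qed
qed

text \<open>
  The pointwise core of the comparison principle. Here \<open>\<xi>\<close> and \<open>\<eta>\<close> stand for \<open>\<nabla>u\<close> and \<open>\<nabla>v\<close>, \<open>\<theta>\<close> for
  \<open>\<nabla>\<zeta> / \<zeta>\<close>, \<open>h\<close> and \<open>h'\<close> for a bounded increasing function of \<open>u\<close> and its derivative, \<open>g\<close> for \<open>f u\<close> and \<open>d\<close>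
  for \<open>f v - f u\<close>. Multiplied by \<open>w \<zeta>\<close>, the right-hand side is the integrand obtained from testing both
  equations with \<open>w\<^sup>2 \<zeta>\<close> and adding \<open>\<mu>\<close> times the equation of \<open>u\<close> tested with \<open>h w\<^sup>3 \<zeta>\<close>. The power 3 in the
  second test function, one more than in the first, makes the cross term
  \<open>\<bar>\<xi>\<bar> powr (p - 1) \<bar>\<xi> - \<eta>\<bar> w\<close> split into \<open>\<bar>\<xi>\<bar> powr p * w\<^sup>2\<close> and the energy. The alternative between a
  lower bound for \<open>h'\<close> and an upper bound for \<open>\<bar>\<xi>\<bar>\<close> allows \<open>u\<close> to be unbounded where its gradient is
  bounded.
\<close>

lemma energy_density_lower_bound:
  fixes p c M h0 K B :: real
  assumes "1 < p" "0 < c" "0 < M" "0 < h0" "0 \<le> K"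
  obtains \<mu> C where "0 < C"
    "\<And>(\<xi>::'a::real_inner) \<eta> \<theta> w h h' g d. \<lbrakk>0 < w; w \<le> M; 0 \<le> h; h \<le> 1; 0 \<le> h';
        h0 \<le> h' \<or> norm \<xi> \<le> K; g \<le> B; c \<le> d\<rbrakk> \<Longrightarrow>
       c / 2 * w - C * w * norm \<theta> powr p
         \<le> 2 * ((p_field p \<xi> - p_field p \<eta>) \<bullet> (\<xi> - \<eta>)) + w * ((p_field p \<xi> - p_field p \<eta>) \<bullet> \<theta>) + d * w
           + \<mu> * (h' * norm \<xi> powr p * w\<^sup>2 + 3 * h * w * (p_field p \<xi> \<bullet> (\<xi> - \<eta>))
                  + h * w\<^sup>2 * (p_field p \<xi> \<bullet> \<theta>) - g * h * w\<^sup>2)"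
proof (cases "p \<le> 2")
  case True
  define \<delta> where "\<delta> = 2 / 2 powr (1 / (p - 1))"
  have \<delta>: "0 < \<delta>" by (simp add: \<delta>_def)
  obtain C where C: "0 < C"
    "\<And>x y. 0 \<le> x \<Longrightarrow> 0 \<le> y \<Longrightarrow> x powr (p - 1) * y powr 1 \<le> \<delta> * x powr p + C * y powr p"
    using young_powr[of "p - 1" 1 \<delta>] \<delta> assms by auto
  show ?thesis
  proof (rule that[of "C * M powr (p - 1)" 0])
    show "0 < C * M powr (p - 1)" using C assms by simp
    fix \<xi> \<eta> \<theta> :: 'a and w h h' g d :: real
    assume w: "0 < w" "w \<le> M" and d: "c \<le> d"
    define E x where "E = (p_field p \<xi> - p_field p \<eta>) \<bullet> (\<xi> - \<eta>)" and "x = norm (p_field p \<xi> - p_field p \<eta>)"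
    have x: "0 \<le> x" by (simp add: x_def)
    have "x powr (p / (p - 1)) \<le> 2 powr (1 / (p - 1)) * E"
      unfolding x_def E_def using p_field_coercive_dual[OF assms(1) True] .
    then have xE: "\<delta> * x powr (p / (p - 1)) \<le> 2 * E"
      by (simp add: \<delta>_def field_simps)
    have "x * (w * norm \<theta>) = (x powr (1 / (p - 1))) powr (p - 1) * (w * norm \<theta>) powr 1"
      using assms x w by (simp add: powr_powr)
    also have "\<dots> \<le> \<delta> * (x powr (1 / (p - 1))) powr p + C * (w * norm \<theta>) powr p"
      using w by (intro C(2)) auto
    also have "\<dots> = \<delta> * x powr (p / (p - 1)) + C * norm \<theta> powr p * (w powr (p - 1) * w powr 1)"
      using w unfolding powr_add[symmetric] by (simp add: powr_powr powr_mult)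
    also have "\<dots> \<le> 2 * E + C * norm \<theta> powr p * (M powr (p - 1) * w)"
      using w C powr_mono2[of "p - 1" w M] assms
      by (intro add_mono[OF xE] mult_left_mono mult_right_mono) auto
    finally have 1: "x * (w * norm \<theta>) \<le> 2 * E + C * M powr (p - 1) * w * norm \<theta> powr p"
      by (simp add: mult_ac)
    have "\<bar>(p_field p \<xi> - p_field p \<eta>) \<bullet> \<theta>\<bar> \<le> x * norm \<theta>"
      unfolding x_def by (rule Cauchy_Schwarz_ineq2)
    then have "w * (- ((p_field p \<xi> - p_field p \<eta>) \<bullet> \<theta>)) \<le> w * (x * norm \<theta>)"
      using w by (intro mult_left_mono) auto
    moreover have "c / 2 * w \<le> d * w" using d w assms by (intro mult_right_mono) auto
    ultimately show "c / 2 * w - C * M powr (p - 1) * w * norm \<theta> powr p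
         \<le> 2 * ((p_field p \<xi> - p_field p \<eta>) \<bullet> (\<xi> - \<eta>)) + w * ((p_field p \<xi> - p_field p \<eta>) \<bullet> \<theta>) + d * w
           + 0 * (h' * norm \<xi> powr p * w\<^sup>2 + 3 * h * w * (p_field p \<xi> \<bullet> (\<xi> - \<eta>))
                  + h * w\<^sup>2 * (p_field p \<xi> \<bullet> \<theta>) - g * h * w\<^sup>2)"
      using 1 unfolding E_def by (simp add: mult_ac)
  qed
next
  case False
  then have p: "2 < p" by simp
  define B' where "B' = h0 * K powr p + \<bar>B\<bar>"
  have B': "0 \<le> B'" using assms by (simp add: B'_def)
  \<comment> \<open>The first entry limits the energy spent on the Caccioppoli errors to one half, the second their
    zero-order part to half of the good term \<open>c w\<close>.\<close>
  define \<mu> where "\<mu> = min (h0 / 36) (c / (2 * (B' + 1) * M))"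
  have \<mu>: "0 < \<mu>" "\<mu> * (18 / h0) \<le> 1/2"
  proof -
    have "0 < c / (2 * (B' + 1) * M)" using assms B' by simp
    then show "0 < \<mu>" using assms by (simp add: \<mu>_def)
    have "\<mu> * (18 / h0) \<le> h0 / 36 * (18 / h0)"
      using assms min.cobounded1[of "h0 / 36"] by (intro mult_right_mono) (auto simp only: \<mu>_def, simp)
    then show "\<mu> * (18 / h0) \<le> 1/2" using assms by simp
  qed
  have \<mu>B: "\<mu> * (B' * M) \<le> c / 2"
  proof -
    have "\<mu> * (B' * M) \<le> c / (2 * (B' + 1) * M) * ((B' + 1) * M)"
      using assms B' \<mu> by (intro mult_mono) (auto simp: \<mu>_def)
    also have "\<dots> = c / 2"
    proof -
      have "B' + 1 \<noteq> 0" "M \<noteq> 0" using assms B' by auto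
      then show ?thesis by (simp del: distrib_left_numeral)
    qed
    finally show ?thesis .
  qed
  \<comment> \<open>The budget is exactly the coefficient of \<open>\<bar>\<xi>\<bar> powr p * w\<^sup>2\<close> that the Caccioppoli term provides.\<close>
  obtain C1 where C1: "0 < C1"
    "\<And>(\<xi>::'a) \<eta> w s. 0 < w \<Longrightarrow> w \<le> M \<Longrightarrow> 0 \<le> s \<Longrightarrow>
       norm (p_field p \<xi> - p_field p \<eta>) * w * s \<le> 3/2 * ((p_field p \<xi> - p_field p \<eta>) \<bullet> (\<xi> - \<eta>))
            + (\<mu> * h0 / 2) * norm \<xi> powr p * w\<^sup>2 + C1 * w * s powr p"
    using flux_difference_absorbed[OF p assms(3), of "\<mu> * h0 / 2"] \<mu> assms by auto
  obtain C2 where C2: "0 < C2"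
    "\<And>x y. 0 \<le> x \<Longrightarrow> 0 \<le> y \<Longrightarrow> x powr (p - 1) * y powr 1 \<le> (h0 / 4) * x powr p + C2 * y powr p"
    using young_powr[of "p - 1" 1 "h0 / 4"] assms by auto
  show ?thesis
  proof (rule that[of "C1 + \<mu> * C2 * M" \<mu>])
    show "0 < C1 + \<mu> * C2 * M" using \<mu> C1 C2 assms by (simp add: add_pos_pos)
    fix \<xi> \<eta> \<theta> :: 'a and w h h' g d :: real
    assume w: "0 < w" "w \<le> M" and h: "0 \<le> h" "h \<le> 1" and h': "0 \<le> h'" "h0 \<le> h' \<or> norm \<xi> \<le> K"
      and g: "g \<le> B" and d: "c \<le> d"
    define E D x s where "E = (p_field p \<xi> - p_field p \<eta>) \<bullet> (\<xi> - \<eta>)"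
      and "D = norm (\<xi> - \<eta>)" and "x = norm \<xi>" and "s = norm \<theta>"
    have nn: "0 \<le> D" "0 \<le> x" "0 \<le> s" by (auto simp: D_def x_def s_def)
    have w2: "w\<^sup>2 \<le> M * w"
      using w by (auto simp: power2_eq_square)
    have SE: "(x powr (p - 2) + norm \<eta> powr (p - 2)) * D\<^sup>2 \<le> 2 * E"
      unfolding x_def D_def E_def using p_field_monotone[OF p] .
    have "x powr (p - 2) * D\<^sup>2 \<le> (x powr (p - 2) + norm \<eta> powr (p - 2)) * D\<^sup>2"
      by (intro mult_right_mono) auto
    with SE have xE: "x powr (p - 2) * D\<^sup>2 \<le> 2 * E" by linarith
    have E: "0 \<le> E"
    proof -
      have "0 \<le> x powr (p - 2) * D\<^sup>2" by simp
      with xE show ?thesis by linarith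
    qed
    have xp: "x powr (p - 1) = x powr (p - 2) * x" "x powr p = x powr (p - 2) * x\<^sup>2"
    proof -
      show "x powr (p - 1) = x powr (p - 2) * x"
        using powr_add[of x "p - 2" 1] nn by simp
      show "x powr p = x powr (p - 2) * x\<^sup>2"
        using powr_add[of x "p - 2" 2] nn by (cases "x = 0") auto
    qed
    have a: "- (w * ((p_field p \<xi> - p_field p \<eta>) \<bullet> \<theta>))
        \<le> 3/2 * E + (\<mu> * h0 / 2) * x powr p * w\<^sup>2 + C1 * w * s powr p"
    proof -
      have "- ((p_field p \<xi> - p_field p \<eta>) \<bullet> \<theta>) \<le> norm (p_field p \<xi> - p_field p \<eta>) * s"
        using Cauchy_Schwarz_ineq2[of "p_field p \<xi> - p_field p \<eta>" \<theta>] by (simp add: s_def)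
      then have "w * (- ((p_field p \<xi> - p_field p \<eta>) \<bullet> \<theta>)) \<le> w * (norm (p_field p \<xi> - p_field p \<eta>) * s)"
        using w by (intro mult_left_mono) auto
      also have "\<dots> \<le> 3/2 * E + (\<mu> * h0 / 2) * x powr p * w\<^sup>2 + C1 * w * s powr p"
        using C1(2)[OF w nn(3), of \<xi> \<eta>] by (simp add: E_def x_def mult_ac)
      finally show ?thesis by simp
    qed
    \<comment> \<open>The factor \<open>h\<close> lies between 0 and 1, so it can be dropped from any nonnegative upper bound.\<close>
    have hstep: "- (h * r) \<le> b" if "- r \<le> b" "0 \<le> b" for r b :: real
    proof -
      have "h * (- r) \<le> h * b" using that h by (intro mult_left_mono) auto
      also have "\<dots> \<le> 1 * b" using that h by (intro mult_right_mono) auto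
      finally show ?thesis by simp
    qed
    have b: "- (h * (3 * w * (p_field p \<xi> \<bullet> (\<xi> - \<eta>)))) \<le> (h0 / 4) * x powr p * w\<^sup>2 + (18 / h0) * E"
    proof (rule hstep)
      have sq: "3 * w * x * D \<le> (h0 / 4) * (w * x)\<^sup>2 + (9 / h0) * D\<^sup>2"
      proof -
        have "0 \<le> (h0 * (w * x) - 6 * D)\<^sup>2" by simp
        also have "\<dots> = (4 * h0) * ((h0 / 4) * (w * x)\<^sup>2 + (9 / h0) * D\<^sup>2 - 3 * w * x * D)"
          using assms by (simp add: power2_eq_square field_simps)
        finally show ?thesis using assms by (simp add: zero_le_mult_iff)
      qed
      have "- (p_field p \<xi> \<bullet> (\<xi> - \<eta>)) \<le> x powr (p - 1) * D"
        using Cauchy_Schwarz_ineq2[of "p_field p \<xi>" "\<xi> - \<eta>"] by (simp add: D_def x_def norm_p_field)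
      then have "3 * w * (- (p_field p \<xi> \<bullet> (\<xi> - \<eta>))) \<le> 3 * w * (x powr (p - 1) * D)"
        using w by (intro mult_left_mono) auto
      also have "\<dots> = x powr (p - 2) * (3 * w * x * D)" by (simp add: xp)
      also have "\<dots> \<le> x powr (p - 2) * ((h0 / 4) * (w * x)\<^sup>2 + (9 / h0) * D\<^sup>2)"
        using sq by (intro mult_left_mono) auto
      also have "\<dots> = (h0 / 4) * x powr p * w\<^sup>2 + (9 / h0) * (x powr (p - 2) * D\<^sup>2)"
        by (simp add: xp algebra_simps)
      also have "\<dots> \<le> (h0 / 4) * x powr p * w\<^sup>2 + (9 / h0) * (2 * E)"
        using xE assms by (intro add_mono mult_left_mono) auto
      finally show "- (3 * w * (p_field p \<xi> \<bullet> (\<xi> - \<eta>))) \<le> (h0 / 4) * x powr p * w\<^sup>2 + (18 / h0) * E"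
        by simp
      show "0 \<le> (h0 / 4) * x powr p * w\<^sup>2 + (18 / h0) * E" using E assms by simp
    qed
    have c: "- (h * (w\<^sup>2 * (p_field p \<xi> \<bullet> \<theta>))) \<le> (h0 / 4) * x powr p * w\<^sup>2 + C2 * M * w * s powr p"
    proof (rule hstep)
      have "- (p_field p \<xi> \<bullet> \<theta>) \<le> x powr (p - 1) * s powr 1"
        using Cauchy_Schwarz_ineq2[of "p_field p \<xi>" \<theta>] by (simp add: s_def x_def norm_p_field)
      also have "\<dots> \<le> (h0 / 4) * x powr p + C2 * s powr p" using nn by (intro C2)
      finally have "w\<^sup>2 * (- (p_field p \<xi> \<bullet> \<theta>)) \<le> w\<^sup>2 * ((h0 / 4) * x powr p + C2 * s powr p)"
        by (rule mult_left_mono) simp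
      also have "\<dots> = (h0 / 4) * x powr p * w\<^sup>2 + C2 * s powr p * w\<^sup>2" by (simp add: algebra_simps)
      also have "\<dots> \<le> (h0 / 4) * x powr p * w\<^sup>2 + C2 * s powr p * (M * w)"
        using w2 C2(1) by (intro add_left_mono mult_left_mono) auto
      finally show "- (w\<^sup>2 * (p_field p \<xi> \<bullet> \<theta>)) \<le> (h0 / 4) * x powr p * w\<^sup>2 + C2 * M * w * s powr p"
        by (simp add: mult_ac)
      show "0 \<le> (h0 / 4) * x powr p * w\<^sup>2 + C2 * M * w * s powr p"
        using assms w C2 by simp
    qed
    have e: "g * h * w\<^sup>2 \<le> \<bar>B\<bar> * w\<^sup>2"
    proof -
      have "g * h \<le> \<bar>B\<bar> * h" using g h by (intro mult_right_mono) auto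
      also have "\<dots> \<le> \<bar>B\<bar> * 1" using h by (intro mult_left_mono) auto
      finally have "g * h \<le> \<bar>B\<bar>" by simp
      then show ?thesis by (intro mult_right_mono) auto
    qed
    have k: "h0 * x powr p * w\<^sup>2 - h0 * K powr p * w\<^sup>2 \<le> h' * x powr p * w\<^sup>2"
    proof -
      have "h0 * x powr p - h0 * K powr p \<le> h' * x powr p"
      proof (cases "h0 \<le> h'")
        case True
        then have "h0 * x powr p \<le> h' * x powr p" by (intro mult_right_mono) auto
        moreover have "0 \<le> h0 * K powr p" using assms by simp
        ultimately show ?thesis by linarith
      next
        case False
        then have "x \<le> K" using h' by (simp add: x_def)
        then have "h0 * x powr p \<le> h0 * K powr p" using assms nn by (intro mult_left_mono powr_mono2) auto
        moreover have "0 \<le> h' * x powr p" using h' by simp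
        ultimately show ?thesis by linarith
      qed
      then have "(h0 * x powr p - h0 * K powr p) * w\<^sup>2 \<le> h' * x powr p * w\<^sup>2" by (intro mult_right_mono) auto
      then show ?thesis by (simp add: algebra_simps)
    qed
    define Q where "Q = h' * x powr p * w\<^sup>2 + 3 * h * w * (p_field p \<xi> \<bullet> (\<xi> - \<eta>))
                  + h * w\<^sup>2 * (p_field p \<xi> \<bullet> \<theta>) - g * h * w\<^sup>2"
    have "(h0 / 2) * x powr p * w\<^sup>2 - (18 / h0) * E - B' * w\<^sup>2 - C2 * M * w * s powr p \<le> Q"
      using b c e k unfolding Q_def B'_def by (simp add: algebra_simps)
    moreover have "B' * w\<^sup>2 \<le> B' * (M * w)" using w2 B' by (intro mult_left_mono)
    ultimately have "(h0 / 2) * x powr p * w\<^sup>2 - (18 / h0) * E - B' * (M * w) - C2 * M * w * s powr p \<le> Q"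
      by linarith
    then have "\<mu> * ((h0 / 2) * x powr p * w\<^sup>2 - (18 / h0) * E - B' * (M * w) - C2 * M * w * s powr p) \<le> \<mu> * Q"
      using \<mu> by (intro mult_left_mono) auto
    then have m: "(\<mu> * h0 / 2) * x powr p * w\<^sup>2 - (\<mu> * (18 / h0)) * E - (\<mu> * (B' * M)) * w
        - \<mu> * C2 * M * w * s powr p \<le> \<mu> * Q"
      by (simp add: algebra_simps)
    have "(\<mu> * (18 / h0)) * E \<le> 1/2 * E" using \<mu> E by (intro mult_right_mono) auto
    moreover have "(\<mu> * (B' * M)) * w \<le> c / 2 * w" using \<mu>B w by (intro mult_right_mono) auto
    moreover have "c * w \<le> d * w" using d w by (intro mult_right_mono) auto
    ultimately have "c / 2 * w - (C1 * w * s powr p + \<mu> * C2 * M * w * s powr p)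
        \<le> 2 * E + w * ((p_field p \<xi> - p_field p \<eta>) \<bullet> \<theta>) + d * w + \<mu> * Q"
      using m a by linarith
    then show "c / 2 * w - (C1 + \<mu> * C2 * M) * w * norm \<theta> powr p
         \<le> 2 * ((p_field p \<xi> - p_field p \<eta>) \<bullet> (\<xi> - \<eta>)) + w * ((p_field p \<xi> - p_field p \<eta>) \<bullet> \<theta>) + d * w
           + \<mu> * (h' * norm \<xi> powr p * w\<^sup>2 + 3 * h * w * (p_field p \<xi> \<bullet> (\<xi> - \<eta>))
                  + h * w\<^sup>2 * (p_field p \<xi> \<bullet> \<theta>) - g * h * w\<^sup>2)"
      unfolding E_def Q_def s_def x_def by (simp add: algebra_simps)
  qed
qed

section \<open>Smooth test functions and weak solutions\<close>

definition C1_on :: "'a::euclidean_space set \<Rightarrow> ('a \<Rightarrow> real) \<Rightarrow> bool" where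
  "C1_on U g \<longleftrightarrow> (\<forall>x\<in>U. g differentiable (at x)) \<and> continuous_on U (grad g)"

text \<open>
  In a Euclidean space the gradient represents the derivative; it is the adjoint applied to 1.
\<close>

lemma GDERIV_grad:
  fixes g :: "'a::euclidean_space \<Rightarrow> real"
  assumes "g differentiable (at x)"
  shows "GDERIV g x :> grad g x"
proof -
  obtain D where D: "(g has_derivative D) (at x)"
    using assms by (auto simp: differentiable_def)
  have "h \<bullet> adjoint D 1 = D h" for h
    using adjoint_works[OF has_derivative_linear[OF D], of h 1] by simp
  then have "GDERIV g x :> adjoint D 1"
    using D unfolding gderiv_def by simp
  then show ?thesis using grad_eqI by metis
qed

lemma GDERIV_transform_open:
  assumes "GDERIV f x :> D" "open U" "x \<in> U" "\<And>y. y \<in> U \<Longrightarrow> f y = g y"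
  shows "GDERIV g x :> D"
  using assms unfolding gderiv_def by (rule has_derivative_transform_within_open)

lemma C1_onD: "C1_on U u \<Longrightarrow> x \<in> U \<Longrightarrow> GDERIV u x :> grad u x"
  by (auto simp: C1_on_def intro: GDERIV_grad)

lemma C1_on_imp_continuous_on: "C1_on U g \<Longrightarrow> continuous_on U g"
  unfolding C1_on_def
  by (intro differentiable_imp_continuous_on) (auto simp: differentiable_on_def differentiable_at_withinI)

text \<open>
  Test functions are built on \<open>\<Omega>\<close> only and extended by zero; a compact set \<open>K\<close> off which the function
  vanishes makes the extension \<open>C\<^sup>1\<close> on the whole space.
\<close>

lemma C1_compact_supportI:
  fixes T :: "'a::euclidean_space \<Rightarrow> real"
  assumes "open \<Omega>" "compact K" "K \<subseteq> \<Omega>"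
    and GD: "\<And>x. x \<in> \<Omega> \<Longrightarrow> GDERIV T x :> G x" and G: "continuous_on \<Omega> G"
    and zero: "\<And>x. x \<notin> K \<Longrightarrow> T x = 0"
  shows "C1_compact_support \<Omega> T" and "\<And>x. x \<in> \<Omega> \<Longrightarrow> grad T x = G x"
proof -
  show grad: "\<And>x. x \<in> \<Omega> \<Longrightarrow> grad T x = G x" using GD grad_eqI by blast
  have K: "open (- K)" using assms(2) by (simp add: compact_imp_closed open_Compl)
  have GD0: "GDERIV T x :> 0" if "x \<in> - K" for x
    using GDERIV_const[of 0 x] K that by (rule GDERIV_transform_open) (use zero in auto)
  then have grad0: "\<And>x. x \<in> - K \<Longrightarrow> grad T x = 0" using grad_eqI by blast
  have "T differentiable (at x)" for x
    using GD[of x] GD0[of x] assms(3) unfolding gderiv_def differentiable_def by (cases "x \<in> K") blast+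
  moreover have "continuous_on (\<Omega> \<union> - K) (grad T)"
  proof (rule continuous_on_open_Un)
    show "continuous_on \<Omega> (grad T)" using G by (rule continuous_on_eq) (simp add: grad)
    show "continuous_on (- K) (grad T)" using continuous_on_const[of _ 0] by (rule continuous_on_eq) (simp add: grad0)
  qed (use assms K in auto)
  moreover have "\<Omega> \<union> - K = UNIV" using assms(3) by auto
  moreover have supp: "closure {x. T x \<noteq> 0} \<subseteq> K"
    using zero assms(2) by (intro closure_minimal) (auto intro: compact_imp_closed)
  moreover have "compact (closure {x. T x \<noteq> 0})"
    using compact_Int_closed[OF assms(2) closed_closure[of "{x. T x \<noteq> 0}"]] supp
    by (simp add: Int_absorb1)
  ultimately show "C1_compact_support \<Omega> T"
    unfolding C1_compact_support_def using assms(3) by auto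
qed

lemma grad_eq_0_off_support:
  fixes \<phi> :: "'a::euclidean_space \<Rightarrow> real"
  assumes "x \<notin> closure {x. \<phi> x \<noteq> 0}"
  shows "\<phi> x = 0" and "grad \<phi> x = 0"
proof -
  show "\<phi> x = 0" using assms closure_subset[of "{x. \<phi> x \<noteq> 0}"] by auto
  have "GDERIV \<phi> x :> 0"
    using GDERIV_const[of 0 x]
    by (rule GDERIV_transform_open[where U = "- closure {x. \<phi> x \<noteq> 0}"])
      (use assms closure_subset[of "{x. \<phi> x \<noteq> 0}"] in auto)
  then show "grad \<phi> x = 0" by (rule grad_eqI)
qed

lemma weak_p_Laplace_solution_subset:
  assumes "weak_p_Laplace_solution p f U u" "V \<subseteq> U"
  shows "weak_p_Laplace_solution p f V u"
  unfolding weak_p_Laplace_solution_def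
proof (intro allI impI)
  fix \<phi> :: "'a \<Rightarrow> real" assume \<phi>: "C1_compact_support V \<phi>"
  have "C1_compact_support U \<phi>" using \<phi> assms(2) unfolding C1_compact_support_def by auto
  then have eq: "(LINT x:U|lebesgue. p_flux p u x \<bullet> grad \<phi> x) = (LINT x:U|lebesgue. f (u x) * \<phi> x)"
    using assms(1) unfolding weak_p_Laplace_solution_def by blast
  have off: "\<phi> x = 0 \<and> grad \<phi> x = 0" if "x \<notin> V" for x
    using \<phi> that grad_eq_0_off_support[of x \<phi>] unfolding C1_compact_support_def by auto
  have "(LINT x:V|lebesgue. p_flux p u x \<bullet> grad \<phi> x) = (LINT x:U|lebesgue. p_flux p u x \<bullet> grad \<phi> x)"
    unfolding set_lebesgue_integral_def using assms(2) off
    by (intro Bochner_Integration.integral_cong) (auto simp: indicator_def)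
  moreover have "(LINT x:V|lebesgue. f (u x) * \<phi> x) = (LINT x:U|lebesgue. f (u x) * \<phi> x)"
    unfolding set_lebesgue_integral_def using assms(2) off
    by (intro Bochner_Integration.integral_cong) (auto simp: indicator_def)
  ultimately show "(LINT x:V|lebesgue. p_flux p u x \<bullet> grad \<phi> x) = (LINT x:V|lebesgue. f (u x) * \<phi> x)"
    using eq by simp
qed

lemma set_integrable_compact_support:
  fixes F :: "'a::euclidean_space \<Rightarrow> real"
  assumes "compact K" "K \<subseteq> \<Omega>" "continuous_on \<Omega> F" "\<And>x. x \<in> \<Omega> - K \<Longrightarrow> F x = 0"
  shows "set_integrable lebesgue \<Omega> F"
proof -
  have "integrable lborel (\<lambda>x. indicator K x *\<^sub>R F x)"
    using assms by (intro borel_integrable_compact continuous_on_subset[OF assms(3)])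
  then have "integrable lebesgue (\<lambda>x. indicator K x *\<^sub>R F x)"
    using integrable_completion[of "\<lambda>x. indicator K x *\<^sub>R F x" lborel] borel_measurable_integrable by auto
  moreover have "(\<lambda>x. indicator K x *\<^sub>R F x) = (\<lambda>x. indicator \<Omega> x *\<^sub>R F x)"
    using assms by (fastforce simp: indicator_def)
  ultimately show ?thesis unfolding set_integrable_def by simp
qed

section \<open>Invariance under reflections and translations\<close>

text \<open>
  For coefficients \<open>c j\<close> in \<open>{-1, 1}\<close> these are the reflections in coordinate hyperplanes, and the
  identity; followed by a translation they cover both the reflection and the horizontal
  translation to which a solution is compared.
\<close>

definition flip :: "('a::euclidean_space \<Rightarrow> real) \<Rightarrow> 'a \<Rightarrow> 'a" where
  "flip c x = (\<Sum>j\<in>Basis. (c j * (x \<bullet> j)) *\<^sub>R j)"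

lemma flip_inner_Basis: "j \<in> Basis \<Longrightarrow> flip c x \<bullet> j = c j * (x \<bullet> j)"
  by (simp add: flip_def)

lemma linear_flip: "linear (flip c)"
  by (intro linearI)
    (simp_all add: flip_def inner_add_left distrib_left scaleR_left_distrib sum.distrib
      scaleR_sum_right mult_ac)

lemma bounded_linear_flip: "bounded_linear (flip c)"
  using linear_flip by (simp add: linear_conv_bounded_linear)

lemmas continuous_on_flip = bounded_linear.continuous_on[OF bounded_linear_flip]

lemma flip_inner_left: "flip c x \<bullet> y = x \<bullet> flip c y"
  by (simp add: flip_def inner_sum_left inner_sum_right inner_commute[of y] mult_ac)

context
  fixes c :: "'a::euclidean_space \<Rightarrow> real"
  assumes c: "\<And>j. j \<in> Basis \<Longrightarrow> c j = 1 \<or> c j = -1"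
begin

lemma flip_flip: "flip c (flip c x) = x"
proof (rule euclidean_eqI)
  fix j :: 'a assume "j \<in> Basis"
  with c[OF this] show "flip c (flip c x) \<bullet> j = x \<bullet> j" by (auto simp: flip_inner_Basis)
qed

lemma norm_flip: "norm (flip c x) = norm x"
  by (simp add: norm_eq_sqrt_inner flip_inner_left flip_flip)

lemma flip_affine_inverse: "\<tau> + flip c (- flip c \<tau> + flip c x) = x" "- flip c \<tau> + flip c (\<tau> + flip c x) = x"
  by (simp_all add: linear_add[OF linear_flip] linear_diff[OF linear_flip] flip_flip)

text \<open>
  Holds for every function, since \<open>F\<close> and its composition are measurable together, and both
  integrals are 0 by convention otherwise.
\<close>

lemma integral_lebesgue_flip:
  fixes F :: "'a \<Rightarrow> real"
  shows "(LINT x|lebesgue. F (\<tau> + flip c x)) = (LINT x|lebesgue. F x)"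
proof -
  have nz: "\<And>j. j \<in> Basis \<Longrightarrow> c j \<noteq> 0" using c by fastforce
  have meas: "(\<lambda>x. t + flip c x) \<in> lebesgue \<rightarrow>\<^sub>M lebesgue" for t
    unfolding flip_def by (rule lebesgue_affine_measurable[OF nz])
  have "(\<Prod>j\<in>Basis. \<bar>c j\<bar>) = (\<Prod>j\<in>(Basis::'a set). (1::real))"
    by (intro prod.cong) (use c in fastforce)+
  then have leb: "lebesgue = density (distr lebesgue lebesgue (\<lambda>x. \<tau> + flip c x)) (\<lambda>_. 1)"
    using lebesgue_affine_euclidean[of c \<tau>, OF nz] by (simp add: flip_def)
  show ?thesis
  proof (cases "F \<in> borel_measurable lebesgue")
    case True
    have "(LINT x|lebesgue. F x) = (LINT x|distr lebesgue lebesgue (\<lambda>x. \<tau> + flip c x). F x)"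
      by (subst leb) (simp add: density_1)
    also have "\<dots> = (LINT x|lebesgue. F (\<tau> + flip c x))"
      using meas True by (rule integral_distr)
    finally show ?thesis by simp
  next
    case False
    have "(\<lambda>x. F (\<tau> + flip c x)) \<notin> borel_measurable lebesgue"
    proof
      assume "(\<lambda>x. F (\<tau> + flip c x)) \<in> borel_measurable lebesgue"
      from measurable_compose[OF meas[of "- flip c \<tau>"] this] show False
        using False unfolding flip_affine_inverse by simp
    qed
    with False show ?thesis
      by (metis borel_measurable_integrable not_integrable_integral_eq)
  qed
qed

lemma GDERIV_flip:
  assumes "GDERIV g (\<tau> + flip c x) :> D"
  shows "GDERIV (\<lambda>x. g (\<tau> + flip c x)) x :> flip c D"
proof -
  have "((\<lambda>x. \<tau> + flip c x) has_derivative flip c) (at x)"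
    using linear_imp_has_derivative[OF linear_flip] by (auto intro!: derivative_eq_intros)
  from has_derivative_compose[OF this assms[unfolded gderiv_def]]
  show ?thesis unfolding gderiv_def by (simp add: flip_inner_left)
qed

text \<open>
  The equation is invariant under isometries: a test function is transported by the inverse map
  \<open>T'\<close>, and both fluxes and gradients are mapped by the same isometry.
\<close>

lemma weak_p_Laplace_solution_flip:
  fixes U :: "'a set" and u :: "'a \<Rightarrow> real" and \<tau> :: 'a and p :: real and f :: "real \<Rightarrow> real"
  assumes U: "open U" and u: "C1_on U u" and weak: "weak_p_Laplace_solution p f U u"
  defines "V \<equiv> {x. \<tau> + flip c x \<in> U}" and "v \<equiv> \<lambda>x. u (\<tau> + flip c x)"
  shows "open V" and "C1_on V v" and "\<And>x. x \<in> V \<Longrightarrow> grad v x = flip c (grad u (\<tau> + flip c x))"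
    and "weak_p_Laplace_solution p f V v"
proof -
  have cont: "continuous_on A (\<lambda>x. t + flip c x)" for A t
    by (intro continuous_on_add continuous_on_const continuous_on_flip continuous_on_id)
  have GD: "GDERIV v x :> flip c (grad u (\<tau> + flip c x))" if "x \<in> V" for x
    unfolding v_def using that u by (intro GDERIV_flip GDERIV_grad) (auto simp: C1_on_def V_def)
  show "open V"
    unfolding V_def using open_vimage[OF U cont[of UNIV]] by (simp add: vimage_def)
  show grad: "grad v x = flip c (grad u (\<tau> + flip c x))" if "x \<in> V" for x
    using GD[OF that] by (rule grad_eqI)
  have "continuous_on V (\<lambda>x. flip c (grad u (\<tau> + flip c x)))"
    using u by (intro continuous_on_flip continuous_on_compose2[of U "grad u", OF _ cont])
      (auto simp: C1_on_def V_def)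
  then show "C1_on V v"
    unfolding C1_on_def using GD
    by (auto simp: gderiv_def differentiable_def grad elim!: continuous_on_eq)
  show "weak_p_Laplace_solution p f V v"
    unfolding weak_p_Laplace_solution_def
  proof (intro allI impI)
    fix \<phi> assume \<phi>: "C1_compact_support V \<phi>"
    define S where "S = closure {x. \<phi> x \<noteq> 0}"
    have S: "compact S" "S \<subseteq> V" using \<phi> by (auto simp: C1_compact_support_def S_def)
    define T' where "T' y = - flip c \<tau> + flip c y" for y
    define \<psi> where "\<psi> = (\<lambda>y. \<phi> (T' y))"
    have K: "compact ((\<lambda>x. \<tau> + flip c x) ` S)" "(\<lambda>x. \<tau> + flip c x) ` S \<subseteq> U"
      using S by (auto intro!: compact_continuous_image cont simp: V_def)
    have GD\<psi>: "GDERIV \<psi> y :> flip c (grad \<phi> (T' y))" for y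
      unfolding \<psi>_def T'_def using \<phi>
      by (intro GDERIV_flip GDERIV_grad) (auto simp: C1_compact_support_def)
    have ct: "continuous_on U (\<lambda>y. flip c (grad \<phi> (T' y)))"
      using \<phi> unfolding T'_def
      by (intro continuous_on_flip continuous_on_compose2[of UNIV "grad \<phi>", OF _ cont])
        (auto simp: C1_compact_support_def)
    have zero: "\<psi> y = 0" if "y \<notin> (\<lambda>x. \<tau> + flip c x) ` S" for y
    proof -
      have "T' y \<notin> S"
        using that flip_affine_inverse(1)[of \<tau> y] unfolding T'_def by (metis imageI)
      then show ?thesis unfolding \<psi>_def S_def by (rule grad_eq_0_off_support)
    qed
    note \<psi> = C1_compact_supportI[OF U K GD\<psi> ct zero]
    have T': "T' (\<tau> + flip c x) = x" for x unfolding T'_def by (rule flip_affine_inverse)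
    have "(LINT x:V|lebesgue. p_flux p v x \<bullet> grad \<phi> x)
        = (LINT x|lebesgue. indicator U (\<tau> + flip c x) *\<^sub>R (p_flux p u (\<tau> + flip c x) \<bullet> grad \<psi> (\<tau> + flip c x)))"
      unfolding set_lebesgue_integral_def
      by (intro Bochner_Integration.integral_cong refl)
        (auto simp: indicator_def V_def \<psi> T' grad[unfolded V_def] p_flux_def norm_flip
          flip_inner_left)
    also have "\<dots> = (LINT y:U|lebesgue. p_flux p u y \<bullet> grad \<psi> y)"
      unfolding set_lebesgue_integral_def by (rule integral_lebesgue_flip)
    also have "\<dots> = (LINT y:U|lebesgue. f (u y) * \<psi> y)"
      using weak \<psi>(1) unfolding weak_p_Laplace_solution_def by blast
    also have "\<dots> = (LINT x|lebesgue. indicator U (\<tau> + flip c x) *\<^sub>R (f (u (\<tau> + flip c x)) * \<psi> (\<tau> + flip c x)))"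
      unfolding set_lebesgue_integral_def by (rule integral_lebesgue_flip[symmetric])
    also have "\<dots> = (LINT x:V|lebesgue. f (v x) * \<phi> x)"
      unfolding set_lebesgue_integral_def
      by (intro Bochner_Integration.integral_cong refl)
        (auto simp: indicator_def V_def v_def \<psi>_def T')
    finally show "(LINT x:V|lebesgue. p_flux p v x \<bullet> grad \<phi> x) = (LINT x:V|lebesgue. f (v x) * \<phi> x)" .
  qed
qed

end

section \<open>Truncations and cut-off functions\<close>

text \<open>
  Powers of the positive part with exponent at least 2 are \<open>C\<^sup>1\<close>, so that truncations yield
  classical test functions and Sobolev spaces can be avoided.
\<close>

lemma DERIV_pos_part_power:
  "((\<lambda>t::real. max 0 t ^ Suc (Suc n)) has_real_derivative real (Suc (Suc n)) * max 0 t ^ Suc n) (at t)"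
proof -
  consider "t < 0" | "t = 0" | "0 < t" by linarith
  then show ?thesis
  proof cases
    case 1
    have "((\<lambda>t::real. 0) has_real_derivative 0) (at t)" by simp
    then have "((\<lambda>t::real. max 0 t ^ Suc (Suc n)) has_real_derivative 0) (at t)"
      by (rule has_field_derivative_transform_within_open[where S = "{..<0}"]) (use 1 in \<open>auto simp: max_def\<close>)
    then show ?thesis using 1 by (simp add: max_def)
  next
    case 2
    have "((\<lambda>h::real. max 0 h ^ Suc n) \<longlongrightarrow> max 0 0 ^ Suc n) (at 0)"
      by (intro tendsto_intros)
    then have "((\<lambda>h::real. max 0 h ^ Suc n) \<longlongrightarrow> 0) (at 0)" by simp
    then have "((\<lambda>h::real. (max 0 (0 + h) ^ Suc (Suc n) - max 0 0 ^ Suc (Suc n)) / h) \<longlongrightarrow> 0) (at 0)"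
      by (rule Lim_transform_eventually) (auto simp: eventually_at_filter max_def)
    then show ?thesis unfolding 2 DERIV_def by simp
  next
    case 3
    have "((\<lambda>t::real. t ^ Suc (Suc n)) has_real_derivative real (Suc (Suc n)) * t ^ Suc n) (at t)"
      by (rule derivative_eq_intros refl)+ simp
    then have "((\<lambda>t::real. max 0 t ^ Suc (Suc n)) has_real_derivative real (Suc (Suc n)) * t ^ Suc n) (at t)"
      by (rule has_field_derivative_transform_within_open[where S = "{0<..}"]) (use 3 in \<open>auto simp: max_def\<close>)
    then show ?thesis using 3 by (simp add: max_def)
  qed
qed

definition bump :: "real \<Rightarrow> 'a::euclidean_space \<Rightarrow> real" where
  "bump R x = max 0 (1 - (x \<bullet> x) / R\<^sup>2)"

lemma bump_nonneg: "0 \<le> bump R x"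
  by (simp add: bump_def)

lemma bump_pos_iff: "0 < R \<Longrightarrow> 0 < bump R x \<longleftrightarrow> norm x < R"
proof -
  assume R: "0 < R"
  have "0 < bump R x \<longleftrightarrow> (norm x)\<^sup>2 < R\<^sup>2"
    using R by (simp add: bump_def power2_norm_eq_inner[symmetric] less_max_iff_disj field_simps)
  also have "\<dots> \<longleftrightarrow> norm x < R"
    using R power_strict_mono[of "norm x" R 2] power2_less_imp_less[of "norm x" R] by auto
  finally show ?thesis .
qed

lemma bump_ge_half:
  assumes "0 < R" "2 * norm x \<le> R"
  shows "1 / 2 \<le> bump R x"
proof -
  have "(2 * norm x)\<^sup>2 \<le> R\<^sup>2" using assms by (intro power_mono) auto
  then have "(norm x)\<^sup>2 / R\<^sup>2 \<le> 1 / 4" using assms by (simp add: field_simps)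
  then have "1 / 2 \<le> 1 - (norm x)\<^sup>2 / R\<^sup>2" by linarith
  then show ?thesis by (simp add: bump_def power2_norm_eq_inner[symmetric] le_max_iff_disj)
qed

definition grad_bump_power :: "nat \<Rightarrow> real \<Rightarrow> 'a::euclidean_space \<Rightarrow> 'a" where
  "grad_bump_power m R x = - (real m * bump R x ^ (m - 1) * (2 / R\<^sup>2)) *\<^sub>R x"

lemma GDERIV_bump_power:
  fixes x :: "'a::euclidean_space"
  assumes "2 \<le> m"
  shows "GDERIV (\<lambda>x. bump R x ^ m) x :> grad_bump_power m R x"
proof -
  obtain n where n: "m = Suc (Suc n)" using assms by (metis add_2_eq_Suc le_Suc_ex)
  have "GDERIV (\<lambda>x::'a. 1 - (x \<bullet> x) / R\<^sup>2) x :> - (2 / R\<^sup>2) *\<^sub>R x"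
    unfolding gderiv_def divide_inverse by (auto intro!: derivative_eq_intros simp: inner_commute)
  from GDERIV_DERIV_compose[OF this DERIV_pos_part_power[of n]]
  show ?thesis unfolding n bump_def grad_bump_power_def by (simp add: mult_ac)
qed

text \<open>
  The gradient of the \<open>m\<close>-th power of the bump, relative to the power itself, is at most
  \<open>(2 m / R) / bump\<close>. Since \<open>bump ^ m\<close> absorbs the \<open>p\<close>-th power of this quotient as long as
  \<open>p < m\<close>, errors of size \<open>R powr (- m)\<close> can be reached.
\<close>

lemma norm_grad_bump_power_le:
  assumes "0 < R" "1 \<le> m" "0 < bump R x"
  shows "norm (grad_bump_power m R x) \<le> bump R x ^ m * ((2 * real m / R) / bump R x)"
proof -
  have "norm x \<le> R" using assms bump_pos_iff[of R x] by simp
  have "norm (grad_bump_power m R x) = real m * bump R x ^ (m - 1) * (2 / R\<^sup>2) * norm x"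
    using bump_nonneg[of R x] by (simp add: grad_bump_power_def abs_mult)
  also have "\<dots> \<le> real m * bump R x ^ (m - 1) * (2 / R\<^sup>2) * R"
    using \<open>norm x \<le> R\<close> bump_nonneg[of R x] by (intro mult_left_mono) auto
  also have "\<dots> = bump R x ^ m * ((2 * real m / R) / bump R x)"
    using assms by (simp add: field_simps power2_eq_square power_eq_if)
  finally show ?thesis .
qed

lemma continuous_on_bump: "continuous_on A (bump R)"
  unfolding bump_def divide_inverse by (intro continuous_intros)

lemma continuous_on_grad_bump_power: "continuous_on A (grad_bump_power m R)"
  unfolding grad_bump_power_def by (intro continuous_intros continuous_on_bump)

section \<open>The comparison principle\<close>

text \<open>
  The weak equation for a test function given on \<open>\<Omega>\<close> by a formula, with both sides collected under
  one integral sign: the form in which several equations can be added.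
\<close>

lemma weak_p_Laplace_solution_testI:
  fixes T :: "'a::euclidean_space \<Rightarrow> real"
  assumes weak: "weak_p_Laplace_solution p f \<Omega> u" and p: "1 < p" and u: "C1_on \<Omega> u"
    and pos: "\<And>x. x \<in> \<Omega> \<Longrightarrow> 0 < u x" and f: "continuous_on {0<..} f"
    and \<Omega>: "open \<Omega>" and K: "compact K" "K \<subseteq> \<Omega>"
    and GD: "\<And>x. x \<in> \<Omega> \<Longrightarrow> GDERIV T x :> G x" and G: "continuous_on \<Omega> G"
    and zero: "\<And>x. x \<in> \<Omega> - K \<Longrightarrow> T x = 0" "\<And>x. x \<in> \<Omega> - K \<Longrightarrow> G x = 0"
  shows "set_integrable lebesgue \<Omega> (\<lambda>x. p_flux p u x \<bullet> G x - f (u x) * T x)"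
    and "(LINT x:\<Omega>|lebesgue. p_flux p u x \<bullet> G x - f (u x) * T x) = 0"
proof -
  define T0 where "T0 x = (if x \<in> \<Omega> then T x else 0)" for x
  have GD0: "GDERIV T0 x :> G x" if "x \<in> \<Omega>" for x
    using GD[OF that] \<Omega> that by (rule GDERIV_transform_open) (simp add: T0_def)
  have "T0 x = 0" if "x \<notin> K" for x using zero(1) that by (auto simp: T0_def)
  note test = C1_compact_supportI[OF \<Omega> K GD0 G this]
  have "continuous_on \<Omega> (p_flux p u)"
    unfolding p_flux_eq_p_field
    by (rule continuous_on_compose2[OF continuous_p_field[OF p]]) (use u in \<open>auto simp: C1_on_def\<close>)
  then have i1: "set_integrable lebesgue \<Omega> (\<lambda>x. p_flux p u x \<bullet> G x)"
    using zero(2) by (intro set_integrable_compact_support[OF K] continuous_on_inner G) auto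
  have "continuous_on \<Omega> (\<lambda>x. f (u x))"
    by (rule continuous_on_compose2[OF f C1_on_imp_continuous_on[OF u]]) (use pos in auto)
  moreover have "continuous_on \<Omega> T"
    using GD by (intro continuous_at_imp_continuous_on ballI)
      (auto simp: gderiv_def intro: has_derivative_continuous)
  ultimately have i2: "set_integrable lebesgue \<Omega> (\<lambda>x. f (u x) * T x)"
    using zero(1) by (intro set_integrable_compact_support[OF K] continuous_on_mult) auto
  show "set_integrable lebesgue \<Omega> (\<lambda>x. p_flux p u x \<bullet> G x - f (u x) * T x)"
    using i1 i2 by (rule set_integral_diff)
  have "(LINT x:\<Omega>|lebesgue. p_flux p u x \<bullet> grad T0 x) = (LINT x:\<Omega>|lebesgue. f (u x) * T0 x)"
    using weak test(1) unfolding weak_p_Laplace_solution_def by blast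
  moreover have "(LINT x:\<Omega>|lebesgue. p_flux p u x \<bullet> grad T0 x) = (LINT x:\<Omega>|lebesgue. p_flux p u x \<bullet> G x)"
    unfolding set_lebesgue_integral_def
    by (intro Bochner_Integration.integral_cong refl) (auto simp: indicator_def test(2))
  moreover have "(LINT x:\<Omega>|lebesgue. f (u x) * T0 x) = (LINT x:\<Omega>|lebesgue. f (u x) * T x)"
    unfolding set_lebesgue_integral_def
    by (intro Bochner_Integration.integral_cong refl) (auto simp: indicator_def T0_def)
  ultimately show "(LINT x:\<Omega>|lebesgue. p_flux p u x \<bullet> G x - f (u x) * T x) = 0"
    using set_integral_diff(2)[OF i1 i2] by simp
qed

text \<open>
  Suppose that \<open>u - v > \<epsilon>\<close> at some point. The pointwise bound turns the tested equations into
  \<open>c / 4 * \<integral> w\<^sup>2 \<zeta> \<le> D / R ^ m * vol (ball R)\<close>, where the right-hand side tends to 0 because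
  \<open>m\<close> exceeds the dimension, whereas the left-hand side stays above a positive constant.
\<close>

lemma comparison_up_to_eps:
  fixes u v :: "'a::euclidean_space \<Rightarrow> real"
  assumes p: "1 < p" and \<Omega>: "open \<Omega>" and f: "continuous_on {0<..} f"
    and u: "C1_on \<Omega> u" "weak_p_Laplace_solution p f \<Omega> u" "\<And>x. x \<in> \<Omega> \<Longrightarrow> 0 < u x"
    and v: "C1_on \<Omega> v" "weak_p_Laplace_solution p f \<Omega> v" "\<And>x. x \<in> \<Omega> \<Longrightarrow> 0 < v x"
    and \<epsilon>: "0 < \<epsilon>" and c: "0 < c"
    and cpt: "\<And>R. compact {x \<in> \<Omega>. \<epsilon> \<le> u x - v x \<and> norm x \<le> R}"
    and M: "\<And>x. x \<in> \<Omega> \<Longrightarrow> u x - v x \<le> M"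
    and gap: "\<And>x. x \<in> \<Omega> \<Longrightarrow> \<epsilon> \<le> u x - v x \<Longrightarrow> c \<le> f (v x) - f (u x)"
    and B: "\<And>x. x \<in> \<Omega> \<Longrightarrow> \<epsilon> \<le> u x - v x \<Longrightarrow> f (u x) \<le> B"
    and K: "\<And>x. x \<in> \<Omega> \<Longrightarrow> \<epsilon> \<le> u x - v x \<Longrightarrow> u x \<le> M \<or> norm (grad u x) \<le> K"
    and x: "x \<in> \<Omega>"
  shows "u x - v x \<le> \<epsilon>"
proof (rule ccontr)
  assume "\<not> u x - v x \<le> \<epsilon>"
  then have x0: "\<epsilon> < u x - v x" by simp
  have M0: "0 < M" using M[OF x] x0 \<epsilon> by linarith
  define w where "w x = max 0 (u x - v x - \<epsilon>)" for x
  define N where "N = DIM('a)"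
  obtain m where m: "m \<ge> Suc N" "p < real m" "2 \<le> m"
  proof -
    obtain m0 where "p < real m0" using reals_Archimedean2 by blast
    then show ?thesis using that[of "m0 + Suc N + 2"] by simp
  qed
  obtain \<mu> C where C: "0 < C" and energy:
    "\<And>(\<xi>::'a) \<eta> \<theta> w h h' g d. \<lbrakk>0 < w; w \<le> M; 0 \<le> h; h \<le> 1; 0 \<le> h';
        exp (- M) \<le> h' \<or> norm \<xi> \<le> \<bar>K\<bar>; g \<le> B; c \<le> d\<rbrakk> \<Longrightarrow>
       c / 2 * w - C * w * norm \<theta> powr p
         \<le> 2 * ((p_field p \<xi> - p_field p \<eta>) \<bullet> (\<xi> - \<eta>)) + w * ((p_field p \<xi> - p_field p \<eta>) \<bullet> \<theta>) + d * w
           + \<mu> * (h' * norm \<xi> powr p * w\<^sup>2 + 3 * h * w * (p_field p \<xi> \<bullet> (\<xi> - \<eta>))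
                  + h * w\<^sup>2 * (p_field p \<xi> \<bullet> \<theta>) - g * h * w\<^sup>2)"
    by (rule energy_density_lower_bound[OF p c M0 exp_gt_zero abs_ge_zero, of "- M" K B]) (rule that)
  obtain C3 where C3: "0 < C3"
    "\<And>a b. 0 \<le> a \<Longrightarrow> 0 \<le> b \<Longrightarrow> a powr (m - p) * b powr p \<le> (c / (4 * C)) * a powr m + C3 * b powr m"
    using young_powr[of "m - p" p "c / (4 * C)"] m p c C by auto
  define D where "D = M\<^sup>2 * C * C3 * (2 * real m) ^ m"
  have D: "0 < D" using M0 C C3 m by (simp add: D_def)

  define H where "H x = 1 - exp (- u x)" for x
  define q where "q x = grad u x - grad v x" for x
  have cu: "continuous_on \<Omega> u" "continuous_on \<Omega> v" "continuous_on \<Omega> (grad u)" "continuous_on \<Omega> (grad v)"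
    using u v C1_on_imp_continuous_on by (auto simp: C1_on_def)
  have cw: "continuous_on \<Omega> w" unfolding w_def by (intro continuous_intros cu)
  have cq: "continuous_on \<Omega> q" unfolding q_def by (intro continuous_intros cu)
  have GDw: "GDERIV (\<lambda>x. w x ^ Suc (Suc n)) x :> (real (Suc (Suc n)) * w x ^ Suc n) *\<^sub>R q x"
    if "x \<in> \<Omega>" for x n
  proof -
    have "GDERIV (\<lambda>x. u x - v x - \<epsilon>) x :> q x - 0"
      unfolding q_def by (intro GDERIV_diff GDERIV_const C1_onD[OF u(1) that] C1_onD[OF v(1) that])
    from GDERIV_DERIV_compose[OF this DERIV_pos_part_power[of n]]
    show ?thesis unfolding w_def by simp
  qed
  have GDw2: "GDERIV (\<lambda>x. w x ^ 2) x :> (2 * w x) *\<^sub>R q x" and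
       GDw3: "GDERIV (\<lambda>x. w x ^ 3) x :> (3 * w x ^ 2) *\<^sub>R q x" if "x \<in> \<Omega>" for x
    using GDw[OF that, of 0] GDw[OF that, of 1] by (simp_all add: numeral_eq_Suc)
  have GDH: "GDERIV H x :> exp (- u x) *\<^sub>R grad u x" if "x \<in> \<Omega>" for x
  proof -
    have "((\<lambda>t. 1 - exp (- t)) has_real_derivative exp (- u x)) (at (u x))"
      by (auto intro!: derivative_eq_intros)
    from GDERIV_DERIV_compose[OF C1_onD[OF u(1) that] this] show ?thesis unfolding H_def .
  qed

  have key: "c / 4 * (LINT x:\<Omega>|lebesgue. (w x)\<^sup>2 * bump R x ^ m) \<le> D / R ^ m * (unit_ball_vol N * R ^ N)"
    and integrable: "set_integrable lebesgue \<Omega> (\<lambda>x. (w x)\<^sup>2 * bump R x ^ m)" if R: "0 < R" for R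
  proof -
    define S where "S = {x \<in> \<Omega>. \<epsilon> \<le> u x - v x \<and> norm x \<le> R}"
    have S: "compact S" "S \<subseteq> \<Omega>" using cpt by (auto simp: S_def)
    define \<zeta> Z where "\<zeta> x = bump R x ^ m" and "Z x = grad_bump_power m R x" for x :: 'a
    have off: "w x = 0 \<or> bump R x = 0" if "x \<in> \<Omega> - S" for x
      using that bump_pos_iff[OF R, of x] bump_nonneg[of R x] by (auto simp: S_def w_def)
    have \<zeta>: "continuous_on A \<zeta>" "continuous_on A Z" for A
      unfolding \<zeta>_def Z_def by (intro continuous_intros continuous_on_bump continuous_on_grad_bump_power)+
    have GD\<zeta>: "GDERIV \<zeta> x :> Z x" for x
      unfolding \<zeta>_def Z_def using m by (intro GDERIV_bump_power)
    have bump0: "\<zeta> x = 0 \<and> Z x = 0" if "bump R x = 0" for x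
      using that m by (simp add: \<zeta>_def Z_def grad_bump_power_def)
    define T1 G1 T2 G2 where "T1 x = (w x)\<^sup>2 * \<zeta> x"
      and "G1 x = (w x)\<^sup>2 *\<^sub>R Z x + \<zeta> x *\<^sub>R ((2 * w x) *\<^sub>R q x)"
      and "T2 x = H x * (w x ^ 3 * \<zeta> x)"
      and "G2 x = H x *\<^sub>R (w x ^ 3 *\<^sub>R Z x + \<zeta> x *\<^sub>R ((3 * w x ^ 2) *\<^sub>R q x)) + (w x ^ 3 * \<zeta> x) *\<^sub>R (exp (- u x) *\<^sub>R grad u x)"
      for x
    have GD1: "GDERIV T1 x :> G1 x" and GD2: "GDERIV T2 x :> G2 x" if "x \<in> \<Omega>" for x
      unfolding T1_def G1_def T2_def G2_def
      by (intro GDERIV_mult GDw2 GDw3 GDH GD\<zeta> that)+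
    have cG: "continuous_on \<Omega> G1" "continuous_on \<Omega> G2"
      unfolding G1_def G2_def H_def by (intro continuous_intros \<zeta> cu cw cq)+
    have off': "T1 x = 0" "G1 x = 0" "T2 x = 0" "G2 x = 0" if "x \<in> \<Omega> - S" for x
      using off[OF that] bump0[of x] unfolding T1_def G1_def T2_def G2_def by auto
    define F1 F2 F3 where "F1 x = p_flux p u x \<bullet> G1 x - f (u x) * T1 x"
      and "F2 x = p_flux p v x \<bullet> G1 x - f (v x) * T1 x"
      and "F3 x = p_flux p u x \<bullet> G2 x - f (u x) * T2 x" for x
    have F1: "set_integrable lebesgue \<Omega> F1" "(LINT x:\<Omega>|lebesgue. F1 x) = 0"
      unfolding F1_def
      by (rule weak_p_Laplace_solution_testI[OF u(2) p u(1,3) f \<Omega> S GD1 cG(1) off'(1,2)]; assumption)+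
    have F2: "set_integrable lebesgue \<Omega> F2" "(LINT x:\<Omega>|lebesgue. F2 x) = 0"
      unfolding F2_def
      by (rule weak_p_Laplace_solution_testI[OF v(2) p v(1,3) f \<Omega> S GD1 cG(1) off'(1,2)]; assumption)+
    have F3: "set_integrable lebesgue \<Omega> F3" "(LINT x:\<Omega>|lebesgue. F3 x) = 0"
      unfolding F3_def
      by (rule weak_p_Laplace_solution_testI[OF u(2) p u(1,3) f \<Omega> S GD2 cG(2) off'(3,4)]; assumption)+
    define L where "L x = (F1 x - F2 x) + \<mu> * F3 x" for x
    note F12 = set_integral_diff[OF F1(1) F2(1)] and \<mu>F3 = set_integrable_mult_right[of \<mu>, OF F3(1)]
    have Lint: "set_integrable lebesgue \<Omega> L"
      unfolding L_def by (rule set_integral_add(1)[OF F12(1) \<mu>F3])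
    have L0: "(LINT x:\<Omega>|lebesgue. L x) = 0"
      unfolding L_def using set_integral_add(2)[OF F12(1) \<mu>F3] F12(2) F1(2) F2(2) F3(2) by simp
    have Tint: "set_integrable lebesgue \<Omega> T1"
      using off'(1) unfolding T1_def
      by (intro set_integrable_compact_support[OF S] continuous_intros cw \<zeta>) auto
    then show "set_integrable lebesgue \<Omega> (\<lambda>x. (w x)\<^sup>2 * bump R x ^ m)"
      unfolding T1_def \<zeta>_def .
    have Sm: "S \<in> lmeasurable" using S(1) by (rule lmeasurable_compact)
    have indS: "indicator \<Omega> x * indicator S x = (indicator S x :: real)" for x
      using S(2) by (auto simp: indicator_def)
    have Sint: "set_integrable lebesgue \<Omega> (indicator S :: 'a \<Rightarrow> real)"
      unfolding set_integrable_def using Sm by (simp add: indS lmeasurable_iff_integrable)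

    have pointwise: "c / 4 * T1 x - D / R ^ m * indicator S x \<le> L x" if x: "x \<in> \<Omega>" for x
    \<comment> \<open>Where \<open>w\<close> or the bump vanishes, all terms vanish; elsewhere \<open>\<nabla>\<zeta> / \<zeta>\<close> makes sense.\<close>
    proof (cases "0 < w x \<and> 0 < bump R x")
      case False
      then have "w x = 0 \<or> bump R x = 0"
        using bump_nonneg[of R x] by (auto simp: w_def)
      then have "T1 x = 0" "L x = 0"
        using bump0[of x] unfolding L_def F1_def F2_def F3_def T1_def G1_def T2_def G2_def by auto
      then show ?thesis using D R by (simp add: indicator_def)
    next
      case True
      then have w0: "0 < w x" and b0: "0 < bump R x" by auto
      have gt: "\<epsilon> \<le> u x - v x" using w0 by (simp add: w_def)
      have xS: "x \<in> S" using off[of x] w0 b0 x by auto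
      have wM: "w x \<le> M" using M[OF x] \<epsilon> M0 by (simp add: w_def)
      have \<zeta>0: "0 < \<zeta> x" using b0 by (simp add: \<zeta>_def)
      define \<theta> where "\<theta> = (1 / \<zeta> x) *\<^sub>R Z x"
      have Z: "Z x = \<zeta> x *\<^sub>R \<theta>" using \<zeta>0 by (simp add: \<theta>_def)
      define y where "y = 2 * real m / R"
      have y: "0 \<le> y" using R by (simp add: y_def)
      have "norm \<theta> = norm (Z x) / \<zeta> x" using \<zeta>0 by (simp add: \<theta>_def)
      also have "\<dots> \<le> y / bump R x"
        using norm_grad_bump_power_le[OF R _ b0, of m] m \<zeta>0
        by (simp add: Z_def \<zeta>_def y_def pos_divide_le_eq mult.commute)
      finally have "norm \<theta> powr p \<le> (y / bump R x) powr p" using p by (intro powr_mono2) auto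
      then have "\<zeta> x * norm \<theta> powr p \<le> bump R x powr m * (y / bump R x) powr p"
        using \<zeta>0 b0 by (simp add: \<zeta>_def powr_realpow mult_left_mono)
      also have "\<dots> = bump R x powr (m - p) * y powr p"
        using b0 y by (simp add: powr_divide powr_diff)
      also have "\<dots> \<le> (c / (4 * C)) * bump R x powr m + C3 * y powr m"
        using b0 y by (intro C3) auto
      also have "\<dots> = (c / (4 * C)) * \<zeta> x + C3 * y ^ m"
        using b0 R m by (simp add: \<zeta>_def powr_realpow y_def)
      finally have "C * (\<zeta> x * norm \<theta> powr p) \<le> C * ((c / (4 * C)) * \<zeta> x + C3 * y ^ m)"
        using C by (intro mult_left_mono) auto
      also have "\<dots> = c / 4 * \<zeta> x + C * C3 * y ^ m" using C by (simp add: field_simps)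
      finally have "(w x)\<^sup>2 * (C * (\<zeta> x * norm \<theta> powr p)) \<le> (w x)\<^sup>2 * (c / 4 * \<zeta> x + C * C3 * y ^ m)"
        by (rule mult_left_mono) simp
      also have "\<dots> = c / 4 * T1 x + (w x)\<^sup>2 * (C * C3 * y ^ m)"
        by (simp add: T1_def algebra_simps)
      also have "\<dots> \<le> c / 4 * T1 x + M\<^sup>2 * (C * C3 * y ^ m)"
        using w0 wM C C3(1) y by (intro add_left_mono mult_right_mono power_mono) auto
      also have "M\<^sup>2 * (C * C3 * y ^ m) = D / R ^ m"
        by (simp add: D_def y_def power_divide)
      finally have err: "(w x)\<^sup>2 * (C * (\<zeta> x * norm \<theta> powr p)) \<le> c / 4 * T1 x + D / R ^ m" .
      have hK: "exp (- M) \<le> exp (- u x) \<or> norm (grad u x) \<le> \<bar>K\<bar>"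
        using K[OF x gt] by auto
      have "c / 2 * w x - C * w x * norm \<theta> powr p
         \<le> 2 * ((p_flux p u x - p_flux p v x) \<bullet> q x) + w x * ((p_flux p u x - p_flux p v x) \<bullet> \<theta>)
           + (f (v x) - f (u x)) * w x
           + \<mu> * (exp (- u x) * norm (grad u x) powr p * (w x)\<^sup>2 + 3 * H x * w x * (p_flux p u x \<bullet> q x)
                  + H x * (w x)\<^sup>2 * (p_flux p u x \<bullet> \<theta>) - f (u x) * H x * (w x)\<^sup>2)" (is "?l \<le> ?r")
        unfolding p_flux_eq_p_field q_def
        by (rule energy[OF w0 wM _ _ _ hK B[OF x gt] gap[OF x gt]]) (use u(3)[OF x] in \<open>auto simp: H_def\<close>)
      then have "(w x * \<zeta> x) * ?l \<le> (w x * \<zeta> x) * ?r"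
        using w0 \<zeta>0 by (intro mult_left_mono) auto
      also have "(w x * \<zeta> x) * ?r = L x"
        unfolding L_def F1_def F2_def F3_def G1_def G2_def T1_def T2_def Z p_field_inner_self[of p "grad u x", symmetric]
          p_flux_eq_p_field[symmetric]
        by (simp add: inner_simps power2_eq_square power3_eq_cube algebra_simps)
      also have "(w x * \<zeta> x) * ?l = c / 2 * T1 x - (w x)\<^sup>2 * (C * (\<zeta> x * norm \<theta> powr p))"
        by (simp add: T1_def power2_eq_square algebra_simps)
      finally show ?thesis using err xS by simp
    qed
    have "(LINT x:\<Omega>|lebesgue. c / 4 * T1 x - D / R ^ m * indicator S x) \<le> (LINT x:\<Omega>|lebesgue. L x)"
      by (intro set_integral_mono Lint set_integral_diff set_integrable_mult_right Tint Sint pointwise)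
    then have "c / 4 * (LINT x:\<Omega>|lebesgue. T1 x) - D / R ^ m * (LINT x:\<Omega>|lebesgue. indicator S x) \<le> 0"
      unfolding L0 by (subst (asm) set_integral_diff)
        (auto intro!: set_integrable_mult_right Tint Sint)
    also have "(LINT x:\<Omega>|lebesgue. indicator S x) = measure lebesgue S"
      unfolding set_lebesgue_integral_def using Sm by (simp add: indS)
    finally have "c / 4 * (LINT x:\<Omega>|lebesgue. T1 x) - D / R ^ m * measure lebesgue S \<le> 0" .
    moreover have "measure lebesgue S \<le> unit_ball_vol N * R ^ N"
    proof -
      have "measure lebesgue S \<le> measure lebesgue (cball (0::'a) R)"
        using Sm by (intro measure_mono_fmeasurable) (auto simp: S_def fmeasurableD)
      also have "\<dots> = unit_ball_vol N * R ^ N" using R by (simp add: content_cball N_def)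
      finally show ?thesis .
    qed
    then have "D / R ^ m * measure lebesgue S \<le> D / R ^ m * (unit_ball_vol N * R ^ N)"
      using D R by (intro mult_left_mono) auto
    ultimately show "c / 4 * (LINT x:\<Omega>|lebesgue. (w x)\<^sup>2 * bump R x ^ m) \<le> D / R ^ m * (unit_ball_vol N * R ^ N)"
      unfolding T1_def \<zeta>_def by linarith
  qed

  obtain r \<kappa> where r: "0 < r" "cball x r \<subseteq> \<Omega>" and \<kappa>: "0 < \<kappa>" "\<And>z. z \<in> cball x r \<Longrightarrow> \<kappa> \<le> w z"
  proof -
    define \<kappa> where "\<kappa> = (u x - v x - \<epsilon>) / 2"
    have \<kappa>: "0 < \<kappa>" "\<kappa> < u x - v x - \<epsilon>" using x0 by (auto simp: \<kappa>_def)
    have "open (\<Omega> \<inter> (\<lambda>z. u z - v z - \<epsilon>) -` {\<kappa><..})"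
      by (intro continuous_open_preimage \<Omega> continuous_intros cu open_greaterThan)
    also have "\<Omega> \<inter> (\<lambda>z. u z - v z - \<epsilon>) -` {\<kappa><..} = {z \<in> \<Omega>. \<kappa> < u z - v z - \<epsilon>}" by auto
    finally have "open {z \<in> \<Omega>. \<kappa> < u z - v z - \<epsilon>}" .
    moreover have "x \<in> {z \<in> \<Omega>. \<kappa> < u z - v z - \<epsilon>}" using \<kappa> x by simp
    ultimately obtain r where "0 < r" "cball x r \<subseteq> {z \<in> \<Omega>. \<kappa> < u z - v z - \<epsilon>}"
      by (meson open_contains_cball)
    then show ?thesis using that[of r \<kappa>] \<kappa> by (force simp: w_def)
  qed
  define b where "b = \<kappa>\<^sup>2 * (1 / 2) ^ m * measure lebesgue (cball x r)"
  have b: "0 < b" using \<kappa> r by (simp add: b_def)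
  have ind: "indicator \<Omega> z *\<^sub>R (\<kappa>\<^sup>2 * (1 / 2) ^ m * indicator (cball x r) z) = \<kappa>\<^sup>2 * (1 / 2) ^ m * indicator (cball x r) z" for z
    using r by (auto simp: indicator_def)
  have lower: "b \<le> (LINT z:\<Omega>|lebesgue. (w z)\<^sup>2 * bump R z ^ m)" if R: "0 < R" "2 * (norm x + r) \<le> R" for R
  proof -
    have "b = (LINT z:\<Omega>|lebesgue. \<kappa>\<^sup>2 * (1 / 2) ^ m * indicator (cball x r) z)"
      unfolding set_lebesgue_integral_def ind b_def by simp
    also have "\<dots> \<le> (LINT z:\<Omega>|lebesgue. (w z)\<^sup>2 * bump R z ^ m)"
    proof (rule set_integral_mono)
      show "set_integrable lebesgue \<Omega> (\<lambda>z. \<kappa>\<^sup>2 * (1 / 2) ^ m * indicator (cball x r) z)"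
        unfolding set_integrable_def ind
        by (intro integrable_mult_right) (simp add: lmeasurable_iff_integrable[symmetric])
      show "set_integrable lebesgue \<Omega> (\<lambda>z. (w z)\<^sup>2 * bump R z ^ m)" using R by (intro integrable)
      fix z assume "z \<in> \<Omega>"
      show "\<kappa>\<^sup>2 * (1 / 2) ^ m * indicator (cball x r) z \<le> (w z)\<^sup>2 * bump R z ^ m"
      proof (cases "z \<in> cball x r")
        case True
        have "norm z \<le> norm x + r"
          using True norm_triangle_sub[of z x] by (auto simp: dist_norm norm_minus_commute)
        then have "1 / 2 \<le> bump R z" using R by (intro bump_ge_half) auto
        then show ?thesis using True \<kappa>(1) \<kappa>(2)[OF True] by (auto intro!: mult_mono power_mono)
      qed (simp add: bump_nonneg)
    qed
    finally show ?thesis .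
  qed
  define V where "V = unit_ball_vol N"
  have V: "0 < V" by (simp add: V_def)
  \<comment> \<open>Large enough for the ball to see \<open>x\<close>, and for the error to fall below half of the lower bound.\<close>
  define R where "R = max 1 (max (2 * (norm x + r)) (8 * D * V / (c * b)))"
  have R: "1 \<le> R" "2 * (norm x + r) \<le> R" "8 * D * V / (c * b) \<le> R" by (auto simp: R_def)
  have "c / 4 * b \<le> c / 4 * (LINT z:\<Omega>|lebesgue. (w z)\<^sup>2 * bump R z ^ m)"
    using lower[of R] R c by (intro mult_left_mono) auto
  also have "\<dots> \<le> D / R ^ m * (V * R ^ N)" using key[of R] R by (simp add: V_def)
  also have "\<dots> \<le> D / R ^ Suc N * (V * R ^ N)"
    using D V R m by (intro mult_right_mono divide_left_mono power_increasing) auto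
  also have "\<dots> = D * V / R" using R by (simp add: field_simps)
  also have "\<dots> \<le> c * b / 8"
    using R c b by (simp add: field_simps)
  finally show False using c b by simp
qed

section \<open>Gaps of strictly decreasing functions\<close>

text \<open>
  On \<open>[\<epsilon> / 2, T]\<close> the gap is bounded below by compactness; for \<open>s\<close> near 0, where \<open>f\<close> may blow up,
  monotonicity suffices, because \<open>t\<close> is then larger than \<open>\<epsilon>\<close>.
\<close>

lemma decreasing_gap:
  fixes f :: "real \<Rightarrow> real"
  assumes f: "continuous_on {0<..} f" "strict_antimono_on {0<..} f" and \<epsilon>: "0 < \<epsilon>"
  obtains c where "0 < c" "\<And>s t. 0 < s \<Longrightarrow> s \<le> T \<Longrightarrow> s + \<epsilon> \<le> t \<Longrightarrow> c \<le> f s - f t"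
proof -
  have dec: "f b < f a" if "0 < a" "a < b" for a b
    using f(2) that by (auto simp: monotone_on_def)
  define T' where "T' = max T (\<epsilon> / 2)"
  have "continuous_on {\<epsilon> / 2 .. T'} (\<lambda>s. f s - f (s + \<epsilon>))"
    using \<epsilon> by (intro continuous_intros continuous_on_compose2[OF f(1)]) auto
  moreover have "{\<epsilon> / 2 .. T'} \<noteq> {}" by (simp add: T'_def)
  ultimately obtain s0 where s0: "s0 \<in> {\<epsilon> / 2 .. T'}"
    "\<And>s. s \<in> {\<epsilon> / 2 .. T'} \<Longrightarrow> f s0 - f (s0 + \<epsilon>) \<le> f s - f (s + \<epsilon>)"
    using continuous_attains_inf[of "{\<epsilon> / 2 .. T'}" "\<lambda>s. f s - f (s + \<epsilon>)"] by auto
  define c where "c = min (f (\<epsilon> / 2) - f \<epsilon>) (f s0 - f (s0 + \<epsilon>))"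
  have "0 < c" using dec[of "\<epsilon> / 2" \<epsilon>] dec[of s0 "s0 + \<epsilon>"] s0(1) \<epsilon> by (auto simp: c_def)
  moreover have "c \<le> f s - f t" if st: "0 < s" "s \<le> T" "s + \<epsilon> \<le> t" for s t
  proof (cases "s < \<epsilon> / 2")
    case True
    have "f (\<epsilon> / 2) < f s" using dec True st by auto
    moreover have "f t < f \<epsilon>" using dec[of \<epsilon> t] st \<epsilon> by auto
    ultimately show ?thesis by (simp add: c_def)
  next
    case False
    have "f t \<le> f (s + \<epsilon>)" using dec[of "s + \<epsilon>" t] st \<epsilon> by (cases "t = s + \<epsilon>") auto
    moreover have "f s0 - f (s0 + \<epsilon>) \<le> f s - f (s + \<epsilon>)"
      using False st by (intro s0) (auto simp: T'_def)
    ultimately show ?thesis by (simp add: c_def)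
  qed
  ultimately show ?thesis by (rule that)
qed

text \<open>
  Beyond the point from which \<open>f' < a < 0\<close>, the mean value theorem bounds the gap below by
  \<open>\<bar>a\<bar> \<epsilon>\<close>.
\<close>

lemma decreasing_gap_unbounded:
  fixes f :: "real \<Rightarrow> real"
  assumes f: "continuous_on {0<..} f" "strict_antimono_on {0<..} f" and \<epsilon>: "0 < \<epsilon>"
    and diff: "\<forall>\<^sub>F t in at_top. f differentiable (at t)"
    and limsup: "Limsup at_top (\<lambda>t. ereal (deriv f t)) < 0"
  obtains c where "0 < c" "\<And>s t. 0 < s \<Longrightarrow> s + \<epsilon> \<le> t \<Longrightarrow> c \<le> f s - f t"
proof -
  obtain a where a: "Limsup at_top (\<lambda>t. ereal (deriv f t)) < ereal a" "ereal a < 0"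
    using ereal_dense2[OF limsup] by auto
  then have "a < 0" by simp
  have "\<forall>\<^sub>F t in at_top. deriv f t < a"
    using Limsup_lessD[OF a(1)] by simp
  with diff have "\<forall>\<^sub>F t in at_top. f differentiable (at t) \<and> deriv f t < a"
    by (rule eventually_conj)
  then obtain T where T: "\<And>t. T \<le> t \<Longrightarrow> f differentiable (at t) \<and> deriv f t < a"
    by (auto simp: eventually_at_top_linorder)
  obtain c where c: "0 < c" "\<And>s t. 0 < s \<Longrightarrow> s \<le> T \<Longrightarrow> s + \<epsilon> \<le> t \<Longrightarrow> c \<le> f s - f t"
    using decreasing_gap[OF f \<epsilon>] by metis
  have "min c (- a * \<epsilon>) \<le> f s - f t" if st: "0 < s" "s + \<epsilon> \<le> t" for s t
  proof (cases "s \<le> T")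
    case True
    then show ?thesis using c(2)[OF st(1) _ st(2)] by simp
  next
    case False
    have "\<exists>z. s < z \<and> z < s + \<epsilon> \<and> f (s + \<epsilon>) - f s = (s + \<epsilon> - s) * deriv f z"
      using False T \<epsilon>
      by (intro MVT2) (auto simp: DERIV_deriv_iff_real_differentiable)
    then obtain z where z: "s < z" "f (s + \<epsilon>) - f s = \<epsilon> * deriv f z" by auto
    have "\<epsilon> * deriv f z \<le> \<epsilon> * a" using T[of z] z False \<epsilon> by (intro mult_left_mono) auto
    moreover have "f t \<le> f (s + \<epsilon>)"
      using f(2) st \<epsilon> by (cases "t = s + \<epsilon>") (auto simp: monotone_on_def less_imp_le)
    ultimately show ?thesis using z by (simp add: mult.commute)
  qed
  moreover have "0 < min c (- a * \<epsilon>)" using c \<open>a < 0\<close> \<epsilon> by (simp add: mult_neg_pos)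
  ultimately show ?thesis using that by blast
qed

section \<open>Half-spaces and strips\<close>

text \<open>
  For a continuous function an almost everywhere bound holds everywhere on an open set, since the set
  where it fails is open and negligible.
\<close>

lemma L_infty_imp_bounded:
  fixes g :: "'a::euclidean_space \<Rightarrow> real"
  assumes "L_infty S' g" "S' \<in> sets lebesgue" "open S" "S \<subseteq> S'" "continuous_on S g"
  obtains C where "\<And>x. x \<in> S \<Longrightarrow> \<bar>g x\<bar> \<le> C"
proof -
  obtain C where "AE x in lebesgue_on S'. \<bar>g x\<bar> \<le> C" using assms(1) by (auto simp: L_infty_def)
  then have "AE x in lebesgue. x \<in> S' \<longrightarrow> \<bar>g x\<bar> \<le> C"
    using assms(2) by (simp add: AE_restrict_space_iff)
  then obtain N where N: "{x. \<not> (x \<in> S' \<longrightarrow> \<bar>g x\<bar> \<le> C)} \<subseteq> N" "N \<in> null_sets lebesgue"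
    by (auto simp: eventually_ae_filter)
  have "open (S \<inter> (\<lambda>x. \<bar>g x\<bar>) -` {C<..})"
    using assms by (intro continuous_open_preimage continuous_intros open_greaterThan)
  moreover have "negligible (S \<inter> (\<lambda>x. \<bar>g x\<bar>) -` {C<..})"
  proof (rule negligible_subset)
    show "negligible N" using N(2) by (simp add: negligible_iff_null_sets)
    show "S \<inter> (\<lambda>x. \<bar>g x\<bar>) -` {C<..} \<subseteq> N" using N(1) assms(4) by auto
  qed
  ultimately have "S \<inter> (\<lambda>x. \<bar>g x\<bar>) -` {C<..} = {}"
    using open_not_negligible by blast
  then show ?thesis using that[of C] by force
qed

lemma closure_halfspace: "closure (halfspace k) = {x. 0 \<le> x $ k}"
  by (simp add: halfspace_def)

lemma open_halfspace: "open (halfspace k)"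
  by (simp add: halfspace_def open_halfspace_component_gt_cart)

lemma frontier_halfspace: "frontier (halfspace k) = {x. x $ k = 0}"
  unfolding frontier_def closure_halfspace interior_open[OF open_halfspace]
  by (auto simp: halfspace_def)

lemma open_strip: "open (strip k l)"
proof -
  have "strip k l = {x. 0 < x $ k} \<inter> {x. x $ k < l}" by (auto simp: strip_def)
  then show ?thesis
    by (simp add: open_Int open_halfspace_component_gt_cart open_halfspace_component_lt_cart)
qed

section \<open>Solutions in the half-space\<close>

text \<open>
  The hypotheses of the theorem in the form in which they enter the argument: pointwise on coordinates,
  with a pointwise upper bound for \<open>u\<close> on each strip.
\<close>

locale halfspace_solution =
  fixes k :: "'n::finite" and p :: real and f :: "real \<Rightarrow> real" and u :: "real ^ 'n \<Rightarrow> real"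
  assumes p: "1 < p"
    and f: "continuous_on {0<..} f" "strict_antimono_on {0<..} f"
    and u: "C1_on (halfspace k) u" "weak_p_Laplace_solution p f (halfspace k) u"
    and cont: "continuous_on {x. 0 \<le> x $ k} u"
    and pos: "\<And>x. 0 < x $ k \<Longrightarrow> 0 < u x"
    and zero: "\<And>x. x $ k = 0 \<Longrightarrow> u x = 0"
    and bounded: "\<And>l. \<exists>C. \<forall>x. 0 < x $ k \<and> x $ k < l \<longrightarrow> u x \<le> C"
begin

lemma f_mono: "0 < s \<Longrightarrow> s \<le> t \<Longrightarrow> f t \<le> f s"
  using f(2) by (cases "s = t") (auto simp: monotone_on_def less_imp_le)

text \<open>
  On the strip below the hyperplane at height \<open>l\<close> the reflected solution is positive at the bottom, where
  \<open>u\<close> vanishes, and equal to \<open>u\<close> at the top. So \<open>u - v \<ge> \<epsilon>\<close> is impossible near the boundary of the strip, and the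
  comparison principle applies.
\<close>

lemma reflection_le:
  assumes x: "0 < x $ k" "x $ k < l"
  shows "u x \<le> u (x + (2 * (l - x $ k)) *\<^sub>R axis k 1)"
proof (rule field_le_epsilon)
  fix \<epsilon> :: real assume \<epsilon>: "0 < \<epsilon>"
  \<comment> \<open>Reflection in the hyperplane at height \<open>l\<close>, as a coordinate flip followed by a translation.\<close>
  define c :: "real ^ 'n \<Rightarrow> real" where "c j = (if j = axis k 1 then - 1 else 1)" for j
  have c: "c j = 1 \<or> c j = - 1" for j by (simp add: c_def)
  define \<tau> :: "real ^ 'n" where "\<tau> = (2 * l) *\<^sub>R axis k 1"
  have refl: "\<tau> + flip c x = x + (2 * (l - x $ k)) *\<^sub>R axis k 1" for x
  proof (rule vec_eq_iff[THEN iffD2], rule allI)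
    fix i
    have axis_component: "axis k (1::real) $ i = (if i = k then 1 else 0)" by (simp add: axis_def)
    have "flip c x $ i = c (axis i 1) * x $ i"
      using flip_inner_Basis[of "axis i 1" c x] by (simp add: inner_axis)
    then show "(\<tau> + flip c x) $ i = (x + (2 * (l - x $ k)) *\<^sub>R axis k 1) $ i"
      by (cases "i = k") (auto simp: \<tau>_def c_def axis_eq_axis inner_axis axis_component algebra_simps)
  qed
  define v where "v x = u (x + (2 * (l - x $ k)) *\<^sub>R axis k 1)" for x
  define V where "V = {x. \<tau> + flip c x \<in> halfspace k}"
  have V: "V = {x. x $ k < 2 * l}" unfolding V_def refl by (auto simp: halfspace_def)
  have v: "C1_on V v" "weak_p_Laplace_solution p f V v"
    using weak_p_Laplace_solution_flip(2,4)[where c = c and \<tau> = \<tau>, OF c open_halfspace u]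
    unfolding V_def v_def refl .
  have sub: "strip k l \<subseteq> V" "strip k l \<subseteq> halfspace k"
    by (auto simp: V strip_def halfspace_def)
  have vpos: "0 < v x" if "0 \<le> x $ k" "x $ k \<le> l" "0 < l" for x
    unfolding v_def using that by (intro pos) simp
  have l: "0 < l" using x by simp
  obtain C where C: "\<And>x. x \<in> strip k l \<Longrightarrow> u x \<le> C" using bounded[of l] by (auto simp: strip_def)
  obtain d where d: "0 < d" "\<And>s t. 0 < s \<Longrightarrow> s \<le> C \<Longrightarrow> s + \<epsilon> \<le> t \<Longrightarrow> d \<le> f s - f t"
    using decreasing_gap[OF f \<epsilon>] by metis
  have "u x - v x \<le> \<epsilon>"
  proof (rule comparison_up_to_eps[OF p open_strip f(1), where c = d and M = C and K = 0])
    show "C1_on (strip k l) u" "C1_on (strip k l) v"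
      using u(1) v(1) sub by (auto simp: C1_on_def intro: continuous_on_subset)
    show "weak_p_Laplace_solution p f (strip k l) u" "weak_p_Laplace_solution p f (strip k l) v"
      using u(2) v(2) sub weak_p_Laplace_solution_subset by blast+
    show "compact {x \<in> strip k l. \<epsilon> \<le> u x - v x \<and> norm x \<le> R}" for R
    proof -
      define A where "A = {x :: real ^ 'n. 0 \<le> x $ k} \<inter> {x. x $ k \<le> l} \<inter> cball 0 R"
      have A: "compact A" unfolding A_def
        by (intro closed_Int_compact closed_Int compact_cball closed_halfspace_component_ge_cart
            closed_halfspace_component_le_cart)
      have "continuous_on A v" unfolding v_def
        by (rule continuous_on_compose2[OF cont]) (auto intro!: continuous_intros simp: A_def)
      moreover have "continuous_on A u"
        by (rule continuous_on_subset[OF cont]) (auto simp: A_def)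
      ultimately have "closed (A \<inter> (\<lambda>x. u x - v x) -` {\<epsilon>..})"
        by (intro continuous_closed_preimage continuous_on_diff compact_imp_closed[OF A] closed_atLeast)
      then have "compact (A \<inter> (A \<inter> (\<lambda>x. u x - v x) -` {\<epsilon>..}))"
        using A by (intro compact_Int_closed)
      also have "A \<inter> (A \<inter> (\<lambda>x. u x - v x) -` {\<epsilon>..}) = {x \<in> strip k l. \<epsilon> \<le> u x - v x \<and> norm x \<le> R}"
      proof -
        have "0 < y $ k \<and> y $ k < l" if y: "0 \<le> y $ k" "y $ k \<le> l" "\<epsilon> \<le> u y - v y" for y
        proof -
          have "y $ k \<noteq> 0" using zero[of y] vpos[of y] y l \<epsilon> by auto
          moreover have "y $ k \<noteq> l" using y(3) \<epsilon> by (auto simp: v_def)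
          ultimately show ?thesis using y by auto
        qed
        then show ?thesis by (auto simp: A_def strip_def)
      qed
      finally show ?thesis .
    qed
    show "0 < u y" "0 < v y" if "y \<in> strip k l" for y
      using that pos vpos l by (auto simp: strip_def)
    show "u y - v y \<le> C" if "y \<in> strip k l" for y
      using that C[OF that] vpos[of y] by (auto simp: strip_def)
    fix y assume y: "y \<in> strip k l" "\<epsilon> \<le> u y - v y"
    have vy: "0 < v y" using y vpos[of y] by (auto simp: strip_def)
    show "d \<le> f (v y) - f (u y)" using C[OF y(1)] y(2) vy \<epsilon> by (intro d) auto
    show "f (u y) \<le> f \<epsilon>" using y(2) vy \<epsilon> by (intro f_mono) auto
    show "u y \<le> C \<or> norm (grad u y) \<le> 0" using C[OF y(1)] by simp
  qed (use x \<epsilon> d in \<open>auto simp: strip_def\<close>)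
  then show "u x \<le> u (x + (2 * (l - x $ k)) *\<^sub>R axis k 1) + \<epsilon>" by (simp add: v_def)
qed

text \<open>
  The midpoint reflection compares \<open>u\<close> at any two points on the same vertical line.
\<close>

lemma grad_component_nonneg:
  assumes x: "0 < x $ k"
  shows "0 \<le> grad u x $ k"
proof (rule ccontr)
  assume neg: "\<not> 0 \<le> grad u x $ k"
  have "GDERIV u (x + 0 *\<^sub>R axis k 1) :> grad u x"
    using C1_onD[OF u(1), of x] x by (simp add: halfspace_def)
  then have "(u has_derivative (\<lambda>h. h \<bullet> grad u x)) (at (x + 0 *\<^sub>R axis k 1))"
    by (simp add: gderiv_def)
  moreover have "((\<lambda>h::real. x + h *\<^sub>R axis k 1) has_derivative (\<lambda>h. h *\<^sub>R axis k 1)) (at 0)"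
    by (auto intro!: derivative_eq_intros)
  ultimately have "((\<lambda>h. u (x + h *\<^sub>R axis k 1)) has_derivative (\<lambda>h. (h *\<^sub>R axis k 1) \<bullet> grad u x)) (at 0)"
    using has_derivative_compose by blast
  then have "((\<lambda>h. u (x + h *\<^sub>R axis k 1)) has_real_derivative grad u x $ k) (at 0)"
    unfolding has_field_derivative_def by (simp add: inner_axis' mult_commute_abs)
  from DERIV_neg_dec_right[OF this] neg obtain d where
    d: "0 < d" "\<And>h. 0 < h \<Longrightarrow> h < d \<Longrightarrow> u (x + h *\<^sub>R axis k 1) < u x"
    by auto
  have "u x \<le> u (x + (2 * (x $ k + d / 4 - x $ k)) *\<^sub>R axis k 1)"
    using x d by (intro reflection_le) auto
  moreover have "2 * (x $ k + d / 4 - x $ k) = d / 2" by simp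
  ultimately show False using d(2)[of "d / 2"] d(1) by simp
qed

text \<open>
  A horizontal translate vanishes on the same boundary, so the set where \<open>u\<close> exceeds it by
  \<open>\<epsilon>\<close> stays away from the boundary. What remains are the bounds at infinity, which differ in the two cases
  of the theorem and are therefore left as assumptions.
\<close>

lemma translation_le_up_to_eps:
  assumes \<tau>: "\<tau> $ k = 0" and \<epsilon>: "0 < \<epsilon>" and c: "0 < c"
    and M: "\<And>x. 0 < x $ k \<Longrightarrow> u x - u (x + \<tau>) \<le> M"
    and gap: "\<And>x. 0 < x $ k \<Longrightarrow> \<epsilon> \<le> u x - u (x + \<tau>) \<Longrightarrow> c \<le> f (u (x + \<tau>)) - f (u x)"
    and K: "\<And>x. 0 < x $ k \<Longrightarrow> \<epsilon> \<le> u x - u (x + \<tau>) \<Longrightarrow> u x \<le> M \<or> norm (grad u x) \<le> K"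
    and x: "0 < x $ k"
  shows "u x - u (x + \<tau>) \<le> \<epsilon>"
proof -
  have id: "\<tau> + flip (\<lambda>_. 1) x = x + \<tau>" for x
    by (simp add: flip_def euclidean_representation)
  define v where "v x = u (x + \<tau>)" for x
  have H: "{x. x + \<tau> \<in> halfspace k} = halfspace k" using \<tau> by (auto simp: halfspace_def)
  have v: "C1_on (halfspace k) v" "weak_p_Laplace_solution p f (halfspace k) v"
    using weak_p_Laplace_solution_flip(2,4)[where c = "\<lambda>_. 1" and \<tau> = \<tau>, OF _ open_halfspace u]
    unfolding id H v_def by auto
  have "u x - v x \<le> \<epsilon>"
  proof (rule comparison_up_to_eps[OF p open_halfspace f(1) u _ v, where c = c and M = M and K = K])
    show "compact {x \<in> halfspace k. \<epsilon> \<le> u x - v x \<and> norm x \<le> R}" for R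
    proof -
      define A where "A = {x :: real ^ 'n. 0 \<le> x $ k} \<inter> cball 0 R"
      have A: "compact A" unfolding A_def
        by (intro closed_Int_compact compact_cball closed_halfspace_component_ge_cart)
      have "continuous_on A v" unfolding v_def
        by (rule continuous_on_compose2[OF cont]) (use \<tau> in \<open>auto intro!: continuous_intros simp: A_def\<close>)
      moreover have "continuous_on A u"
        by (rule continuous_on_subset[OF cont]) (auto simp: A_def)
      ultimately have "closed (A \<inter> (\<lambda>x. u x - v x) -` {\<epsilon>..})"
        by (intro continuous_closed_preimage continuous_on_diff compact_imp_closed[OF A] closed_atLeast)
      then have "compact (A \<inter> (A \<inter> (\<lambda>x. u x - v x) -` {\<epsilon>..}))"
        using A by (intro compact_Int_closed)
      also have "A \<inter> (A \<inter> (\<lambda>x. u x - v x) -` {\<epsilon>..}) = {x \<in> halfspace k. \<epsilon> \<le> u x - v x \<and> norm x \<le> R}"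
      proof -
        have "y $ k \<noteq> 0" if "\<epsilon> \<le> u y - v y" for y
          using that zero[of y] zero[of "y + \<tau>"] \<tau> \<epsilon> by (auto simp: v_def)
        then show ?thesis by (force simp: A_def halfspace_def)
      qed
      finally show ?thesis .
    qed
    show "f (u y) \<le> f \<epsilon>" if "y \<in> halfspace k" "\<epsilon> \<le> u y - v y" for y
      using that pos[of "y + \<tau>"] \<tau> \<epsilon> by (intro f_mono) (auto simp: v_def halfspace_def)
  qed (use x \<epsilon> c \<tau> M gap K pos in \<open>auto simp: halfspace_def v_def\<close>)
  then show ?thesis by (simp add: v_def)
qed

lemma translation_difference_le:
  assumes \<tau>: "\<tau> $ k = 0" and x: "0 < x $ k" and e: "\<And>y. y $ k = x $ k \<Longrightarrow> norm (grad u y) \<le> e"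
  shows "u x - u (x + \<tau>) \<le> e * norm \<tau>"
proof -
  \<comment> \<open>A horizontal translation stays in the hyperplane through \<open>x\<close>, so only the gradient there matters.\<close>
  define S where "S = {y :: real ^ 'n. y $ k = x $ k}"
  have "norm (u x - u (x + \<tau>)) \<le> e * norm (x - (x + \<tau>))"
  proof (rule differentiable_bound[where S = S])
    show "convex S" by (auto simp: S_def convex_def distrib_right[symmetric])
    show "(u has_derivative (\<lambda>h. h \<bullet> grad u y)) (at y within S)" if "y \<in> S" for y
      using C1_onD[OF u(1), of y] that x unfolding gderiv_def
      by (auto simp: S_def halfspace_def intro: has_derivative_at_withinI)
    show "onorm (\<lambda>h. h \<bullet> grad u y) \<le> e" if "y \<in> S" for y
    proof (rule onorm_bound)
      have ny: "norm (grad u y) \<le> e" using that by (intro e) (simp add: S_def)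
      then show "0 \<le> e" using norm_ge_zero order_trans by blast
      show "norm (h \<bullet> grad u y) \<le> e * norm h" for h
        using Cauchy_Schwarz_ineq2[of h "grad u y"] mult_left_mono[OF ny norm_ge_zero[of h]]
        by (simp add: mult.commute)
    qed
  qed (use \<tau> in \<open>auto simp: S_def\<close>)
  then show ?thesis by simp
qed

lemma one_dimensionalI:
  assumes "\<And>x \<tau> \<epsilon>. 0 < x $ k \<Longrightarrow> \<tau> $ k = 0 \<Longrightarrow> 0 < \<epsilon> \<Longrightarrow> u x - u (x + \<tau>) \<le> \<epsilon>"
  shows "\<exists>v. \<forall>x. 0 \<le> x $ k \<longrightarrow> u x = v (x $ k)"
proof (intro exI allI impI)
  fix x :: "real ^ 'n" assume x: "0 \<le> x $ k"
  define y :: "real ^ 'n" where "y = (x $ k) *\<^sub>R axis k 1"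
  have y: "y $ k = x $ k" by (simp add: y_def)
  have le: "u a \<le> u b" if "0 < a $ k" "b $ k = a $ k" for a b
  proof (rule field_le_epsilon)
    fix \<epsilon> :: real assume "0 < \<epsilon>"
    then have "u a - u (a + (b - a)) \<le> \<epsilon>" using that by (intro assms) auto
    then show "u a \<le> u b + \<epsilon>" by simp
  qed
  have "u x = u y"
  proof (cases "x $ k = 0")
    case True
    then show ?thesis using zero y by simp
  next
    case False
    then show ?thesis using x y by (intro antisym le) auto
  qed
  then show "u x = u ((x $ k) *\<^sub>R axis k 1)" by (simp add: y_def)
qed

text \<open>
  By the mean value inequality a translate differs from \<open>u\<close> by less than \<open>\<epsilon>\<close> above some height \<open>T\<close>. Hence the
  set where the difference is at least \<open>\<epsilon>\<close> lies in a strip, on which \<open>u\<close> is bounded.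
\<close>

lemma one_dimensional_if_gradient_vanishes:
  assumes "gradient_vanishes_at_infinity k u"
  shows "\<exists>v. \<forall>x. 0 \<le> x $ k \<longrightarrow> u x = v (x $ k)"
proof (rule one_dimensionalI)
  fix x \<tau> :: "real ^ 'n" and \<epsilon> :: real
  assume x: "0 < x $ k" and \<tau>: "\<tau> $ k = 0" and \<epsilon>: "0 < \<epsilon>"
  define e where "e = \<epsilon> / (2 * (norm \<tau> + 1))"
  have e: "0 < e" using \<epsilon> by (simp add: e_def add_nonneg_pos)
  have e\<tau>: "e * norm \<tau> < \<epsilon>"
  proof -
    have "e * norm \<tau> < e * (2 * (norm \<tau> + 1))" using e by (intro mult_strict_left_mono) (auto simp: add_nonneg_pos)
    also have "\<dots> = \<epsilon>"
    proof -
      have "norm \<tau> + 1 \<noteq> 0" using norm_ge_zero[of \<tau>] by linarith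
      then show ?thesis by (simp add: e_def)
    qed
    finally show ?thesis .
  qed
  have "\<forall>\<^sub>F t in at_top. \<forall>y\<in>{y. y $ k = 0}. dist (norm (grad u (y + t *\<^sub>R axis k 1))) 0 < e"
    using uniform_limitD[OF assms[unfolded gradient_vanishes_at_infinity_def] e] .
  then obtain T where T: "\<And>t y. T \<le> t \<Longrightarrow> y $ k = 0 \<Longrightarrow> norm (grad u (y + t *\<^sub>R axis k 1)) < e"
    by (auto simp: eventually_at_top_linorder)
  have far: "norm (grad u y) \<le> e" if "T \<le> y $ k" for y
    using T[OF that, of "y - (y $ k) *\<^sub>R axis k 1"] by simp
  obtain C where C: "\<And>y. 0 < y $ k \<Longrightarrow> y $ k < T \<Longrightarrow> u y \<le> C" using bounded[of T] by auto
  have near: "u y \<le> C" if "0 < y $ k" "\<epsilon> \<le> u y - u (y + \<tau>)" for y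
  proof (cases "y $ k < T")
    case False
    then have "u y - u (y + \<tau>) \<le> e * norm \<tau>"
      using that(1) by (intro translation_difference_le[OF \<tau>] far) auto
    then show ?thesis using that e\<tau> by simp
  qed (use that C in auto)
  obtain c where c: "0 < c" "\<And>s t. 0 < s \<Longrightarrow> s \<le> C \<Longrightarrow> s + \<epsilon> \<le> t \<Longrightarrow> c \<le> f s - f t"
    using decreasing_gap[OF f \<epsilon>] by metis
  have pos\<tau>: "0 < u (y + \<tau>)" if "0 < y $ k" for y using that \<tau> by (intro pos) simp
  show "u x - u (x + \<tau>) \<le> \<epsilon>"
  proof (rule translation_le_up_to_eps[OF \<tau> \<epsilon> c(1) _ _ _ x, where M = "max C \<epsilon>" and K = 0])
    fix y :: "real ^ 'n" assume y: "0 < y $ k"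
    show "u y - u (y + \<tau>) \<le> max C \<epsilon>"
      using near[OF y] pos\<tau>[OF y] by (cases "\<epsilon> \<le> u y - u (y + \<tau>)") (auto simp: max_def)
    assume "\<epsilon> \<le> u y - u (y + \<tau>)"
    then show "c \<le> f (u (y + \<tau>)) - f (u y)" and "u y \<le> max C \<epsilon> \<or> norm (grad u y) \<le> 0"
      using near[OF y] pos\<tau>[OF y] \<epsilon> by (auto intro!: c)
  qed
qed

text \<open>
  Here \<open>u\<close> may be unbounded, but its difference to a translate is bounded: by the mean value
  inequality above height \<open>l\<close> and by the bound for \<open>u\<close> below it. At each point either \<open>u\<close> or its
  gradient is bounded, as the comparison principle requires.
\<close>

lemma one_dimensional_if_gradient_bounded:
  assumes diff: "\<forall>\<^sub>F t in at_top. f differentiable (at t)"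
    and limsup: "Limsup at_top (\<lambda>t. ereal (deriv f t)) < 0"
    and K: "\<And>x. l < x $ k \<Longrightarrow> norm (grad u x) \<le> K" and l: "0 < l"
  shows "\<exists>v. \<forall>x. 0 \<le> x $ k \<longrightarrow> u x = v (x $ k)"
proof (rule one_dimensionalI)
  fix x \<tau> :: "real ^ 'n" and \<epsilon> :: real
  assume x: "0 < x $ k" and \<tau>: "\<tau> $ k = 0" and \<epsilon>: "0 < \<epsilon>"
  obtain C where C: "\<And>y. 0 < y $ k \<Longrightarrow> y $ k < l + 1 \<Longrightarrow> u y \<le> C" using bounded[of "l + 1"] by auto
  obtain c where c: "0 < c" "\<And>s t. 0 < s \<Longrightarrow> s + \<epsilon> \<le> t \<Longrightarrow> c \<le> f s - f t"
    using decreasing_gap_unbounded[OF f \<epsilon> diff limsup] by metis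
  have pos\<tau>: "0 < u (y + \<tau>)" if "0 < y $ k" for y using that \<tau> by (intro pos) simp
  show "u x - u (x + \<tau>) \<le> \<epsilon>"
  proof (rule translation_le_up_to_eps[OF \<tau> \<epsilon> c(1) _ _ _ x, where M = "max C (K * norm \<tau>)" and K = K])
    fix y :: "real ^ 'n" assume y: "0 < y $ k"
    show "u y - u (y + \<tau>) \<le> max C (K * norm \<tau>)"
    proof (cases "l < y $ k")
      case True
      then have "u y - u (y + \<tau>) \<le> K * norm \<tau>"
        using y by (intro translation_difference_le[OF \<tau>] K) auto
      then show ?thesis by simp
    next
      case False
      then show ?thesis using C[of y] y pos\<tau>[of y] by simp
    qed
    show "u y \<le> max C (K * norm \<tau>) \<or> norm (grad u y) \<le> K"
      using C[of y] K[of y] y by (cases "l < y $ k") auto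
    assume "\<epsilon> \<le> u y - u (y + \<tau>)"
    then show "c \<le> f (u (y + \<tau>)) - f (u y)" using pos\<tau>[OF y] by (intro c) auto
  qed
qed

end

section \<open>Monotonicity and one-dimensional symmetry\<close>

theorem theorem7:
  fixes k :: "'n::finite"
    and p \<alpha> :: real
    and f :: "real \<Rightarrow> real"
    and u :: "real ^ 'n \<Rightarrow> real"
  assumes "p > 1"
    and "locally_lipschitz_on {0<..} f"
    and "\<exists>L::ereal. L > 0 \<and> ((\<lambda>t. ereal (f t)) \<longlongrightarrow> L) (at_right 0)"
    and "strict_antimono_on {0<..} f"
    and "0 < \<alpha>" and "\<alpha> < 1"
    and "C1_alpha_loc \<alpha> (halfspace k) u"
    and "continuous_on (closure (halfspace k)) u"
    and "weak_p_Laplace_solution p f (halfspace k) u"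
    and "\<forall>x\<in>halfspace k. u x > 0"
    and "\<forall>x\<in>frontier (halfspace k). u x = 0"
    and "\<forall>l>0. L_infty (strip k l) u"
  shows "(\<forall>x\<in>halfspace k. grad u x $ k \<ge> 0) \<and>
    (gradient_vanishes_at_infinity k u \<or>
     ((\<forall>\<^sub>F t in at_top. f differentiable (at t)) \<and>
      Limsup at_top (\<lambda>t. ereal (deriv f t)) < 0 \<and>
      (\<exists>l>0. L_infty (halfspace k - strip k l) (\<lambda>x. norm (grad u x))))
     \<longrightarrow> (\<exists>v :: real \<Rightarrow> real. \<forall>x\<in>closure (halfspace k). u x = v (x $ k)))"
proof -
  have C1: "C1_on (halfspace k) u"
    using assms(7) by (auto simp: C1_on_def C1_alpha_loc_def)
  interpret halfspace_solution k p f u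
  proof
    show "1 < p" by fact
    show "continuous_on {0<..} f"
      using local_lipschitz_continuous_on[OF assms(2)[unfolded locally_lipschitz_on_def]] by auto
    show "strict_antimono_on {0<..} f" by fact
    show "C1_on (halfspace k) u" by fact
    show "weak_p_Laplace_solution p f (halfspace k) u" by fact
    show "continuous_on {x. 0 \<le> x $ k} u" using assms(8) unfolding closure_halfspace .
    show "0 < u x" if "0 < x $ k" for x using assms(10) that by (simp add: halfspace_def)
    show "u x = 0" if "x $ k = 0" for x using assms(11) that by (simp add: frontier_halfspace)
    show "\<exists>C. \<forall>x. 0 < x $ k \<and> x $ k < l \<longrightarrow> u x \<le> C" for l
    proof (cases "0 < l")
      case True
      have "continuous_on (strip k l) u"
        using C1_on_imp_continuous_on[OF C1] by (rule continuous_on_subset) (auto simp: strip_def halfspace_def)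
      moreover have "strip k l \<in> sets lebesgue" by (intro sets_completionI_sets) (simp add: open_strip)
      ultimately obtain C where C: "\<And>x. x \<in> strip k l \<Longrightarrow> \<bar>u x\<bar> \<le> C"
        using assms(12) True L_infty_imp_bounded[of "strip k l" u "strip k l"] open_strip[of k l] by blast
      then show ?thesis by (intro exI[of _ C]) (auto simp: strip_def abs_le_iff)
    qed auto
  qed
  have gradient_bounded_case: "\<exists>v. \<forall>x. 0 \<le> x $ k \<longrightarrow> u x = v (x $ k)"
    if "(\<forall>\<^sub>F t in at_top. f differentiable (at t))" "Limsup at_top (\<lambda>t. ereal (deriv f t)) < 0"
      and l: "0 < l" "L_infty (halfspace k - strip k l) (\<lambda>x. norm (grad u x))" for l
  proof -
    define S where "S = {x :: real ^ 'n. l < x $ k}"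
    have "halfspace k - strip k l \<in> sets lebesgue"
      by (intro sets_completionI_sets) (simp add: open_strip open_halfspace sets.Diff)
    moreover have "open S" by (simp add: S_def open_halfspace_component_gt_cart)
    moreover have "S \<subseteq> halfspace k - strip k l" using l by (auto simp: S_def halfspace_def strip_def)
    moreover have "continuous_on S (\<lambda>x. norm (grad u x))"
      using C1 l by (intro continuous_on_norm) (auto simp: C1_on_def S_def halfspace_def elim: continuous_on_subset)
    ultimately obtain K where "\<And>x. x \<in> S \<Longrightarrow> \<bar>norm (grad u x)\<bar> \<le> K"
      using L_infty_imp_bounded[OF l(2)] by blast
    then show ?thesis
      using that(1,2) l(1) by (intro one_dimensional_if_gradient_bounded[of l K]) (auto simp: S_def)
  qed
  show ?thesis
  proof (intro conjI impI)
    show "\<forall>x\<in>halfspace k. 0 \<le> grad u x $ k"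
      using grad_component_nonneg by (simp add: halfspace_def)
    assume "gradient_vanishes_at_infinity k u \<or>
     ((\<forall>\<^sub>F t in at_top. f differentiable (at t)) \<and>
      Limsup at_top (\<lambda>t. ereal (deriv f t)) < 0 \<and>
      (\<exists>l>0. L_infty (halfspace k - strip k l) (\<lambda>x. norm (grad u x))))"
    then have "\<exists>v. \<forall>x. 0 \<le> x $ k \<longrightarrow> u x = v (x $ k)"
      using one_dimensional_if_gradient_vanishes gradient_bounded_case by blast
    then show "\<exists>v :: real \<Rightarrow> real. \<forall>x\<in>closure (halfspace k). u x = v (x $ k)"
      by (simp add: closure_halfspace)
  qed
qed

end
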